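(* Let $A$ be a unital C*-algebra and let $\{\mathcal M, \langle\cdot,\cdot\rangle_{\mathcal M}\}$ and $\{\mathcal N, \langle\cdot,\cdot\rangle_{\mathcal N}\}$ be two (algebraically) finitely generated Hilbert $A$-modules, with norms $\|x\|_{\mathcal M}=\|\langle x,x\rangle_{\mathcal M}\|^{1/2}$ and $\|y\|_{\mathcal N}=\|\langle y,y\rangle_{\mathcal N}\|^{1/2}$. Then the following conditions are equivalent: (i) $\{\mathcal M,\|\cdot\|_{\mathcal M}\}$ and $\{\mathcal N,\|\cdot\|_{\mathcal N}\}$ are isometrically isomorphic as Banach $A$-modules. (ii) $\{\mathcal M,\langle\cdot,\cdot\rangle_{\mathcal M}\}$ and $\{\mathcal N,\langle\cdot,\cdot\rangle_{\mathcal N}\}$ are unitarily isomorphic as Hilbert $A$-modules. (iii) There are finite normalized tight frames $\{x_1,\dots,x_k\}$ of $\mathcal M$ and $\{y_1,\dots,y_l\}$ of $\mathcal N$ such that $k=l$, $x_i\neq 0$ and $y_i\neq 0$ for every $i=1,\dots,k$, and $\langle x_i,x_j\rangle_{\mathcal M}=\langle y_i,y_j\rangle_{\mathcal N}$ for all $1\le i\le j\le k$.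
   Context: Modules are left $A$-modules whose linear structure is compatible with that of $A$. An $A$-valued inner product $\langle\cdot,\cdot\rangle:\mathcal M\times\mathcal M\to A$ satisfies $\langle x,x\rangle\ge 0$, $\langle x,x\rangle=0$ iff $x=0$, $\langle x,y\rangle=\langle y,x\rangle^*$, $\langle ax,y\rangle=a\langle x,y\rangle$ for $a\in A$, and additivity in the first argument. A Hilbert $A$-module is such a module that is complete for the norm $\|x\|=\|\langle x,x\rangle\|^{1/2}$. It is (algebraically) finitely generated if there are finitely many elements $x_1,\dots,x_n$ such that every $x$ is of the form $\sum_i a_ix_i$ with $a_i\in A$. Two Hilbert $A$-modules are unitarily isomorphic if there is a bounded $A$-linear isomorphism between them preserving the values of the $A$-valued inner products. They are isometrically isomorphic as Banach $A$-modules if there is an isometric $A$-linear bijection between them. A finite family $\{x_1,\dots,x_k\}$ in a Hilbert $A$-module $\mathcal M$ is a normalized tight frame of $\mathcal M$ if $\langle x,x\rangle=\sum_{j=1}^k\langle x,x_j\rangle\langle x_j,x\rangle$ for every $x\in\mathcal M$. *)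

theory Defs
  imports Complex_Main "HOL-Library.Nonpos_Ints"
begin

class complex_vector = ab_group_add +
  fixes scaleC :: "complex \<Rightarrow> 'a \<Rightarrow> 'a" (infixr "*\<^sub>C" 75)
  assumes scaleC_add_right: "c *\<^sub>C (x + y) = c *\<^sub>C x + c *\<^sub>C y"
    and scaleC_add_left: "(c + d) *\<^sub>C x = c *\<^sub>C x + d *\<^sub>C x"
    and scaleC_scaleC: "c *\<^sub>C d *\<^sub>C x = (c * d) *\<^sub>C x"
    and scaleC_one: "1 *\<^sub>C x = x"

text \<open>The unit is taken from \<^class>\<open>monoid_mult\<close>: the class \<^class>\<open>ring_1\<close>, and hence
  \<^class>\<open>real_normed_algebra_1\<close>, would impose \<open>0 \<noteq> 1\<close> and exclude the zero algebra.\<close>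

class unital_cstar_algebra = complex_vector + real_normed_algebra + banach + monoid_mult +
  fixes star :: "'a \<Rightarrow> 'a"
  assumes scaleC_of_real: "complex_of_real r *\<^sub>C x = r *\<^sub>R x"
    and scaleC_mult_left: "(c *\<^sub>C x) * y = c *\<^sub>C (x * y)"
    and scaleC_mult_right: "x * (c *\<^sub>C y) = c *\<^sub>C (x * y)"
    and norm_scaleC: "norm (c *\<^sub>C x) = cmod c * norm x"
    and star_star: "star (star x) = x"
    and star_add: "star (x + y) = star x + star y"
    and star_scaleC: "star (c *\<^sub>C x) = cnj c *\<^sub>C star x"
    and star_mult: "star (x * y) = star y * star x"
    and cstar_identity: "norm (star x * x) = (norm x)\<^sup>2"

definition cstar_spectrum :: "'a::unital_cstar_algebra \<Rightarrow> complex set" where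
  "cstar_spectrum a =
     {c. \<not> (\<exists>b. (a - c *\<^sub>C 1) * b = 1 \<and> b * (a - c *\<^sub>C 1) = 1)}"

definition cstar_pos :: "'a::unital_cstar_algebra \<Rightarrow> bool" where
  "cstar_pos a \<longleftrightarrow> star a = a \<and> cstar_spectrum a \<subseteq> \<real>\<^sub>\<ge>\<^sub>0"

definition hm_norm :: "('m \<Rightarrow> 'm \<Rightarrow> 'a::unital_cstar_algebra) \<Rightarrow> 'm \<Rightarrow> real" where
  "hm_norm ip x = sqrt (norm (ip x x))"

locale hilbert_module =
  fixes act :: "'a::unital_cstar_algebra \<Rightarrow> 'm::complex_vector \<Rightarrow> 'm"
    and ip :: "'m \<Rightarrow> 'm \<Rightarrow> 'a"
  assumes act_add_right: "act a (x + y) = act a x + act a y"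
    and act_add_left: "act (a + b) x = act a x + act b x"
    and act_act: "act a (act b x) = act (a * b) x"
    and act_one: "act 1 x = x"
    and act_scaleC_left: "act (c *\<^sub>C a) x = c *\<^sub>C act a x"
    and act_scaleC_right: "act a (c *\<^sub>C x) = c *\<^sub>C act a x"
    and ip_pos: "cstar_pos (ip x x)"
    and ip_eq_zero_iff: "ip x x = 0 \<longleftrightarrow> x = 0"
    and ip_star: "ip x y = star (ip y x)"
    and ip_act_left: "ip (act a x) y = a * ip x y"
    and ip_add_left: "ip (x + y) z = ip x z + ip y z"
    and complete: "(\<forall>e>0. \<exists>n0. \<forall>m\<ge>n0. \<forall>n\<ge>n0. hm_norm ip (X m - X n) < e)
      \<Longrightarrow> \<exists>x. (\<lambda>n. hm_norm ip (X n - x)) \<longlonglongrightarrow> 0"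

definition finitely_generated ::
    "('a::unital_cstar_algebra \<Rightarrow> 'm::complex_vector \<Rightarrow> 'm) \<Rightarrow> bool" where
  "finitely_generated act \<longleftrightarrow>
     (\<exists>(n::nat) g. \<forall>x. \<exists>a. x = (\<Sum>i = 1..n. act (a i) (g i)))"

text \<open>Since the algebra is unital and acts compatibly with the complex scalars, maps that are
  linear over it are automatically complex linear.\<close>

definition module_linear ::
    "('a::unital_cstar_algebra \<Rightarrow> 'm::complex_vector \<Rightarrow> 'm) \<Rightarrow>
     ('a \<Rightarrow> 'n::complex_vector \<Rightarrow> 'n) \<Rightarrow> ('m \<Rightarrow> 'n) \<Rightarrow> bool" where
  "module_linear actM actN T \<longleftrightarrow>
     (\<forall>x y. T (x + y) = T x + T y) \<and> (\<forall>a x. T (actM a x) = actN a (T x))"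

definition isometrically_isomorphic ::
    "('a::unital_cstar_algebra \<Rightarrow> 'm::complex_vector \<Rightarrow> 'm) \<Rightarrow> ('m \<Rightarrow> 'm \<Rightarrow> 'a) \<Rightarrow>
     ('a \<Rightarrow> 'n::complex_vector \<Rightarrow> 'n) \<Rightarrow> ('n \<Rightarrow> 'n \<Rightarrow> 'a) \<Rightarrow> bool" where
  "isometrically_isomorphic actM ipM actN ipN \<longleftrightarrow>
     (\<exists>T. module_linear actM actN T \<and> bij T \<and> (\<forall>x. hm_norm ipN (T x) = hm_norm ipM x))"

definition unitarily_isomorphic ::
    "('a::unital_cstar_algebra \<Rightarrow> 'm::complex_vector \<Rightarrow> 'm) \<Rightarrow> ('m \<Rightarrow> 'm \<Rightarrow> 'a) \<Rightarrow>
     ('a \<Rightarrow> 'n::complex_vector \<Rightarrow> 'n) \<Rightarrow> ('n \<Rightarrow> 'n \<Rightarrow> 'a) \<Rightarrow> bool" where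
  "unitarily_isomorphic actM ipM actN ipN \<longleftrightarrow>
     (\<exists>T. module_linear actM actN T \<and> bij T \<and>
          (\<exists>K. \<forall>x. hm_norm ipN (T x) \<le> K * hm_norm ipM x) \<and>
          (\<forall>x y. ipN (T x) (T y) = ipM x y))"

text \<open>The family is \<open>f 1, \<dots>, f k\<close>. The value \<open>k = 0\<close> is allowed: the zero module has
  no other frame consisting of nonzero elements.\<close>

definition normalized_tight_frame ::
    "('m::complex_vector \<Rightarrow> 'm \<Rightarrow> 'a::unital_cstar_algebra) \<Rightarrow> nat \<Rightarrow> (nat \<Rightarrow> 'm) \<Rightarrow> bool" where
  "normalized_tight_frame ip k f \<longleftrightarrow>
     (\<forall>x. ip x x = (\<Sum>j = 1..k. ip x (f j) * ip (f j) x))"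

end

theory Submission
  imports Defs "HOL-Analysis.Analysis"
begin

text \<open>If an \<open>A\<close>-linear bijection \<open>T\<close> is isometric, then \<open>a\<langle>x,x\<rangle>a\<^sup>*\<close> and \<open>a\<langle>Tx,Tx\<rangle>a\<^sup>*\<close> have the
  same norm for every \<open>a\<close>. Choosing \<open>a = (\<langle>x,x\<rangle> + e)\<close> to the power \<open>-1/2\<close> gives
  \<open>\<langle>Tx,Tx\<rangle> \<le> \<langle>x,x\<rangle> + e\<close>, and by symmetry and polarization \<open>T\<close> is unitary.
  For a finite generating family, completeness of the module makes the frame operator \<open>S\<close> invertible,
  and \<open>S\<close> to the power \<open>-1/2\<close>, obtained as the limit of a Newton iteration, turns the generators into
  a normalized tight frame. Conversely, two normalized tight frames with the same Gram
  matrix are matched by the unitary \<open>z \<mapsto> \<Sum>\<^sub>i \<langle>z,x\<^sub>i\<rangle>y\<^sub>i\<close>.\<close>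

subsection \<open>Elementary facts on star and inverses\<close>

text \<open>Spectral statements are expressed through invertibility; no functional calculus enters.
  Three facts carry the C*-algebra part: the norm of a self-adjoint element is controlled by its
  real spectrum, so that order bounds and norm bounds can be exchanged; \<open>star v * v\<close> is
  positive; a positive element has a self-adjoint square root after an arbitrarily small positive
  shift. The shift \<open>e\<close> is there because \<open>ip x x\<close> need not be invertible;
  it disappears at the end since positivity passes to limits. These roots do not help with the frame
  operator, which acts on the module and is not an element of the algebra. Hence the separate Newton
  iteration, carried out on maps and evaluated pointwise.\<close>

lemma scaleC_zero_right [simp]: "c *\<^sub>C (0::'a::complex_vector) = 0"
  using scaleC_add_right[of c 0 "0::'a"] by simp

lemma scaleC_zero_left [simp]: "0 *\<^sub>C (x::'a::complex_vector) = 0"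
  using scaleC_add_left[of 0 0 x] by simp

lemma scaleC_minus_right: "c *\<^sub>C (- x) = - (c *\<^sub>C (x::'a::complex_vector))"
  using scaleC_add_right[of c x "- x"] by (simp add: eq_neg_iff_add_eq_0 add.commute)

lemma scaleC_minus_left: "(- c) *\<^sub>C x = - (c *\<^sub>C (x::'a::complex_vector))"
  using scaleC_add_left[of c "- c" x] by (simp add: eq_neg_iff_add_eq_0 add.commute)

lemma scaleC_diff_right: "c *\<^sub>C (x - y) = c *\<^sub>C x - c *\<^sub>C (y::'a::complex_vector)"
  using scaleC_add_right[of c x "- y"] by (simp add: scaleC_minus_right)

lemma scaleC_diff_left: "(c - d) *\<^sub>C x = c *\<^sub>C x - d *\<^sub>C (x::'a::complex_vector)"
  using scaleC_add_left[of c "- d" x] by (simp add: scaleC_minus_left)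

lemma star_zero [simp]: "star (0::'a::unital_cstar_algebra) = 0"
  using star_add[of 0 "0::'a"] by simp

lemma star_minus: "star (- x) = - star (x::'a::unital_cstar_algebra)"
  using star_add[of x "- x"] by (simp add: eq_neg_iff_add_eq_0 add.commute)

lemma star_diff: "star (x - y) = star x - star (y::'a::unital_cstar_algebra)"
  using star_add[of x "- y"] by (simp add: star_minus)

lemma star_scaleR: "star (r *\<^sub>R x) = r *\<^sub>R star (x::'a::unital_cstar_algebra)"
  using star_scaleC[of "complex_of_real r" x] by (simp add: scaleC_of_real)

lemma star_one [simp]: "star (1::'a::unital_cstar_algebra) = 1"
  using star_mult[of "star 1" "1::'a"] by (simp add: star_star)

lemma star_sum: "star (\<Sum>i\<in>I. f i) = (\<Sum>i\<in>I. star (f i :: 'a::unital_cstar_algebra))"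
  by (induction I rule: infinite_finite_induct) (simp_all add: star_add)

lemma star_power: "star (x ^ n) = star (x::'a::unital_cstar_algebra) ^ n"
  by (induction n) (simp_all add: star_mult power_commutes)

lemma norm_star [simp]: "norm (star x) = norm (x::'a::unital_cstar_algebra)"
proof -
  have le: "norm y \<le> norm (star y)" for y :: 'a
  proof (cases "norm y = 0")
    case False
    have "norm y * norm y \<le> norm (star y) * norm y"
      using norm_mult_ineq[of "star y" y] cstar_identity[of y] by (simp add: power2_eq_square)
    then show ?thesis using False by simp
  qed simp
  show ?thesis using le[of x] le[of "star x"] by (simp add: star_star)
qed

lemma norm_mult_star: "norm (x * star x) = (norm (x::'a::unital_cstar_algebra))\<^sup>2"
  using cstar_identity[of "star x"] by (simp add: star_star)

text \<open>By the C*-identity \<open>norm 1\<close> equals its own square. The value 0 occurs in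
  the zero algebra, which the class admits, hence an inequality.\<close>

lemma norm_one_le: "norm (1::'a::unital_cstar_algebra) \<le> 1"
proof -
  have "norm (1::'a) = norm (1::'a) * norm (1::'a)"
    using cstar_identity[of "1::'a"] by (simp add: power2_eq_square)
  then show ?thesis by (metis mult_cancel_left1 norm_ge_zero order_refl zero_le_one)
qed

lemma norm_scaleR_one_le: "norm (r *\<^sub>R (1::'a::unital_cstar_algebra)) \<le> \<bar>r\<bar>"
  using mult_left_mono[OF norm_one_le, of "\<bar>r\<bar>"] by simp

lemma norm_square_self_adjoint:
  "star x = x \<Longrightarrow> norm (x * x) = (norm (x::'a::unital_cstar_algebra))\<^sup>2"
  using cstar_identity[of x] by simp

text \<open>The C*-identity computes norms of squares, hence the exponents \<open>2 ^ k\<close>;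
  this is why the averaging argument below proceeds by doubling.\<close>

lemma norm_power_self_adjoint:
  assumes "star (x::'a::unital_cstar_algebra) = x"
  shows "norm (x ^ (2 ^ k)) = norm x ^ (2 ^ k)"
proof (induction k)
  case (Suc k)
  have "x ^ (2 ^ Suc k) = x ^ (2 ^ k) * x ^ (2 ^ k)"
    by (simp add: power_add[symmetric] mult_2)
  moreover have "star (x ^ (2 ^ k)) = x ^ (2 ^ k)"
    by (simp add: star_power assms)
  ultimately have "norm (x ^ (2 ^ Suc k)) = (norm x ^ (2 ^ k))\<^sup>2"
    using norm_square_self_adjoint Suc by metis
  then show ?case by (simp add: power_mult[symmetric] mult.commute)
qed simp

lemma bounded_linear_star: "bounded_linear (star :: 'a::unital_cstar_algebra \<Rightarrow> 'a)"
  by (rule bounded_linear_intro[where K = 1]) (simp_all add: star_add star_scaleR)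

section \<open>Invertible elements and their perturbation\<close>

definition has_inv :: "'a::unital_cstar_algebra \<Rightarrow> bool" where
  "has_inv a \<longleftrightarrow> (\<exists>b. a * b = 1 \<and> b * a = 1)"

lemma has_invI: "a * b = 1 \<Longrightarrow> b * a = 1 \<Longrightarrow> has_inv a"
  by (auto simp: has_inv_def)

lemma has_invE:
  assumes "has_inv a" obtains b where "a * b = 1" "b * a = 1"
  using assms by (auto simp: has_inv_def)

lemma inverse_unique:
  assumes "b * a = 1" "a * c = (1::'a::unital_cstar_algebra)" shows "b = c"
  by (metis assms mult.assoc mult_1_left mult_1_right)

lemma inverse_self_adjoint:
  assumes "star a = a" "a * b = 1" "b * a = (1::'a::unital_cstar_algebra)"
  shows "star b = b"
proof -
  have "star b * a = 1" using arg_cong[OF assms(2), of star] assms(1) by (simp add: star_mult)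
  then show ?thesis using inverse_unique assms(2) by blast
qed

lemma has_inv_one [simp]: "has_inv 1"
  by (rule has_invI[of _ 1]) simp_all

lemma has_inv_mult: "has_inv a \<Longrightarrow> has_inv b \<Longrightarrow> has_inv (a * b)"
proof (elim has_invE)
  fix c d assume h: "a * c = 1" "c * a = 1" "b * d = 1" "d * b = 1"
  show ?thesis
  proof (rule has_invI[of _ "d * c"])
    have "a * b * (d * c) = a * (b * d) * c" by (simp only: mult.assoc)
    then show "a * b * (d * c) = 1" by (simp add: h)
    have "d * c * (a * b) = d * (c * a) * b" by (simp only: mult.assoc)
    then show "d * c * (a * b) = 1" by (simp add: h)
  qed
qed

lemma has_inv_scaleC: "c \<noteq> 0 \<Longrightarrow> has_inv a \<Longrightarrow> has_inv (c *\<^sub>C a)"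
proof (elim has_invE)
  fix b assume "c \<noteq> 0" "a * b = 1" "b * a = 1"
  then show ?thesis
    by (intro has_invI[of _ "inverse c *\<^sub>C b"])
      (simp_all add: scaleC_mult_left scaleC_mult_right scaleC_scaleC scaleC_one)
qed

lemma has_inv_minus: "has_inv a \<Longrightarrow> has_inv (- a)"
  using has_inv_scaleC[of "-1" a] by (simp add: scaleC_minus_left scaleC_one)

lemma has_inv_minus_iff [simp]: "has_inv (- a) \<longleftrightarrow> has_inv a"
  using has_inv_minus[of a] has_inv_minus[of "- a"] by auto

text \<open>Jacobson's trick: if \<open>u\<close> is thought of as the sum of the powers of
  \<open>x * y\<close>, then \<open>1 + y * u * x\<close> is the sum of the powers of
  \<open>y * x\<close>. So \<open>x * y\<close> and \<open>y * x\<close> share their nonzero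
  spectrum.\<close>

lemma has_inv_one_minus_mult_swap:
  assumes "has_inv (1 - x * y)" shows "has_inv (1 - y * x)"
proof -
  obtain u where u: "(1 - x * y) * u = 1" "u * (1 - x * y) = 1"
    using assms by (rule has_invE)
  have u1: "x * y * u = u - 1" "u * x * y = u - 1"
    using u by (auto simp: algebra_simps)
  show ?thesis
  proof (rule has_invI[of _ "1 + y * u * x"])
    have "(1 - y * x) * (1 + y * u * x) = 1 - y * x + y * u * x - y * (x * y * u) * x"
      by (simp add: algebra_simps)
    also have "\<dots> = 1" unfolding u1 by (simp add: algebra_simps)
    finally show "(1 - y * x) * (1 + y * u * x) = 1" .
    have "(1 + y * u * x) * (1 - y * x) = 1 - y * x + y * u * x - y * (u * x * y) * x"
      by (simp add: algebra_simps)
    also have "\<dots> = 1" unfolding u1 by (simp add: algebra_simps)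
    finally show "(1 + y * u * x) * (1 - y * x) = 1" .
  qed
qed

lemma norm_power_le: "norm (x ^ n) \<le> norm (x::'a::unital_cstar_algebra) ^ n"
proof (induction n)
  case (Suc n)
  have "norm (x ^ Suc n) \<le> norm x * norm (x ^ n)" using norm_mult_ineq[of x "x ^ n"] by simp
  also have "\<dots> \<le> norm x * norm x ^ n" using Suc by (simp add: mult_left_mono)
  finally show ?case by simp
qed (simp add: norm_one_le)

lemma has_inv_one_minus:
  assumes "norm (x::'a::unital_cstar_algebra) < 1" shows "has_inv (1 - x)"
proof -
  have "summable (\<lambda>n. norm x ^ n)" using assms by (simp add: summable_geometric)
  then have "summable (\<lambda>n. norm (x ^ n))"
    by (rule summable_comparison_test[rotated]) (simp add: norm_power_le)
  then have s: "summable (\<lambda>n. x ^ n)" by (rule summable_norm_cancel)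
  define b where "b = (\<Sum>n. x ^ n)"
  have split: "b = 1 + (\<Sum>n. x ^ Suc n)"
    unfolding b_def using suminf_split_head[OF s] by simp
  have "(\<Sum>n. x ^ Suc n) = x * b"
    unfolding b_def using suminf_mult[OF s, of x] by simp
  moreover have "(\<Sum>n. x ^ Suc n) = b * x"
    unfolding b_def using suminf_mult2[OF s, of x] by (simp add: power_commutes)
  ultimately show ?thesis using split
    by (intro has_invI[of _ b]) (simp_all add: algebra_simps)
qed

text \<open>Factor \<open>a' = a * (1 - b * (a - a'))\<close> and invert the second factor by the
  Neumann series.\<close>

lemma has_inv_perturb:
  assumes "a * b = 1" "b * a = 1" "norm (a - a') * norm b < 1"
  shows "has_inv (a'::'a::unital_cstar_algebra)"
proof -
  have "norm (b * (a - a')) < 1"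
    using norm_mult_ineq[of b "a - a'"] assms(3) by (simp add: mult.commute)
  then have "has_inv (1 - b * (a - a'))" by (rule has_inv_one_minus)
  then have "has_inv (a * (1 - b * (a - a')))" using assms has_inv_mult has_invI by blast
  moreover have "a * (1 - b * (a - a')) = a - (a * b) * (a - a')"
    by (simp only: right_diff_distrib mult.assoc mult_1_right)
  ultimately show ?thesis by (simp add: assms)
qed

lemma has_inv_diff_scaleC:
  assumes "norm (a::'a::unital_cstar_algebra) < cmod c" shows "has_inv (a - c *\<^sub>C 1)"
proof -
  have c: "c \<noteq> 0" using assms norm_ge_zero[of a] by auto
  have "norm (inverse c *\<^sub>C a) < 1"
    using assms c by (simp add: norm_scaleC norm_inverse mult.commute pos_divide_less_eq
        flip: divide_inverse)
  then have "has_inv ((- c) *\<^sub>C (1 - inverse c *\<^sub>C a))"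
    using c by (intro has_inv_scaleC has_inv_one_minus) auto
  then show ?thesis
    using c by (simp add: scaleC_diff_right scaleC_minus_left scaleC_scaleC scaleC_one)
qed

lemma has_inv_diff_scaleR:
  assumes "norm (a::'a::unital_cstar_algebra) < \<bar>r\<bar>" shows "has_inv (a - r *\<^sub>R 1)"
  using has_inv_diff_scaleC[of a "complex_of_real r"] assms by (simp add: scaleC_of_real)

text \<open>Shifting \<open>a\<close> and \<open>c\<close> by the same imaginary number
  \<open>i s\<close> does not change \<open>a - c\<close>. The C*-identity gives
  \<open>norm w ^ 2 \<le> norm a ^ 2 + s ^ 2\<close>, whereas the squared modulus of
  \<open>c + i s\<close> contains the linear term \<open>2 * Im c * s\<close>. The choice of
  \<open>s\<close> makes this term \<open>norm a ^ 2 + 1\<close>, so the shifted point lies outside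
  the disc of radius \<open>norm w\<close>.\<close>

lemma has_inv_self_adjoint_nonreal:
  assumes sa: "star (a::'a::unital_cstar_algebra) = a" and im: "Im c \<noteq> 0"
  shows "has_inv (a - c *\<^sub>C 1)"
proof -
  define s where "s = ((norm a)\<^sup>2 + 1) / (2 * Im c)"
  define w where "w = a + (\<i> * complex_of_real s) *\<^sub>C 1"
  have ss: "star w * w = a * a + (s\<^sup>2) *\<^sub>R 1"
  proof -
    have "star w = a - (\<i> * complex_of_real s) *\<^sub>C 1"
      by (simp add: w_def star_add star_scaleC sa scaleC_minus_left)
    then have "star w * w = a * a - ((\<i> * complex_of_real s) * (\<i> * complex_of_real s)) *\<^sub>C 1"
      unfolding w_def
      by (simp only: left_diff_distrib distrib_left scaleC_diff_right scaleC_mult_left scaleC_mult_right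
          scaleC_scaleC mult_1_left mult_1_right) (simp add: algebra_simps)
    moreover have "(\<i> * complex_of_real s) * (\<i> * complex_of_real s) = - complex_of_real (s\<^sup>2)"
      by (simp add: complex_eq_iff power2_eq_square)
    ultimately show ?thesis by (simp only: scaleC_minus_left scaleC_of_real) simp
  qed
  have "norm (a * a + (s\<^sup>2) *\<^sub>R 1) \<le> norm (a * a) + norm ((s\<^sup>2) *\<^sub>R (1::'a))"
    by (rule norm_triangle_ineq)
  also have "\<dots> \<le> (norm a)\<^sup>2 + s\<^sup>2"
    using norm_scaleR_one_le[of "s\<^sup>2", where 'a='a] norm_square_self_adjoint[OF sa] by simp
  finally have "(norm w)\<^sup>2 \<le> (norm a)\<^sup>2 + s\<^sup>2" using ss cstar_identity[of w] by simp
  also have "\<dots> < (cmod (c + \<i> * complex_of_real s))\<^sup>2"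
  proof -
    have "2 * Im c * s = (norm a)\<^sup>2 + 1" using im by (simp add: s_def)
    then have "(Im c + s)\<^sup>2 = (Im c)\<^sup>2 + (norm a)\<^sup>2 + 1 + s\<^sup>2"
      by (simp add: power2_eq_square algebra_simps)
    then show ?thesis unfolding cmod_power2 by (simp add: add_nonneg_pos add_pos_nonneg add.commute)
  qed
  finally have "norm w < cmod (c + \<i> * complex_of_real s)"
    by (rule power2_less_imp_less) simp
  then have "has_inv (w - (c + \<i> * complex_of_real s) *\<^sub>C 1)" by (rule has_inv_diff_scaleC)
  then show ?thesis by (simp add: w_def scaleC_add_left)
qed

subsection \<open>The norm of a self-adjoint element\<close>

definition some_inv :: "'a::unital_cstar_algebra \<Rightarrow> 'a" where
  "some_inv a = (SOME b. a * b = 1 \<and> b * a = 1)"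

lemma some_inv:
  assumes "has_inv a" shows "a * some_inv a = 1" "some_inv a * a = 1"
proof -
  have "a * some_inv a = 1 \<and> some_inv a * a = 1"
    unfolding some_inv_def using assms unfolding has_inv_def by (rule someI_ex)
  then show "a * some_inv a = 1" "some_inv a * a = 1" by auto
qed

text \<open>The identity \<open>c' - c = c' * (a - a') * c\<close> still involves
  \<open>norm c'\<close>; the smallness hypothesis absorbs it through
  \<open>norm c' \<le> 2 * norm c\<close>.\<close>

lemma norm_inverse_diff_le:
  assumes c: "a * c = 1" "c * a = 1" and c': "a' * c' = 1" "c' * a' = (1::'a::unital_cstar_algebra)"
    and le: "norm (a - a') * norm c \<le> 1 / 2"
  shows "norm (c' - c) \<le> 2 * (norm c)\<^sup>2 * norm (a - a')"
proof -
  have eq: "c' - c = c' * (a - a') * c"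
    using c c' by (simp add: left_diff_distrib right_diff_distrib mult.assoc)
  then have "norm (c' - c) \<le> norm (c' * (a - a')) * norm c" by (simp add: norm_mult_ineq)
  also have "\<dots> \<le> norm c' * norm (a - a') * norm c"
    by (simp add: norm_mult_ineq mult_right_mono)
  finally have d: "norm (c' - c) \<le> norm c' * norm (a - a') * norm c" .
  also have "\<dots> \<le> norm c' * (1 / 2)"
    using mult_left_mono[OF le, of "norm c'"] by (simp add: mult.assoc)
  finally have "norm c' \<le> 2 * norm c" using norm_triangle_sub[of c' c] by simp
  then have "norm c' * (norm (a - a') * norm c) \<le> (2 * norm c) * (norm (a - a') * norm c)"
    by (intro mult_right_mono) auto
  with d show ?thesis by (simp add: power2_eq_square algebra_simps)
qed

lemma continuous_on_resolvent:
  fixes b :: "'a::unital_cstar_algebra"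
  assumes inv: "\<And>z. z \<in> S \<Longrightarrow> has_inv (1 - z *\<^sub>C b)"
  shows "continuous_on S (\<lambda>z. some_inv (1 - z *\<^sub>C b))"
proof (unfold continuous_on_iff, intro ballI allI impI)
  fix z and e :: real assume z: "z \<in> S" and e: "e > 0"
  define B where "B = norm (some_inv (1 - z *\<^sub>C b))"
  define L where "L = (norm b + 1) * (B + 1)"
  have L: "L > 0" by (simp add: L_def B_def add_nonneg_pos)
  \<comment> \<open>The first entry meets the threshold of \<open>norm_inverse_diff_le\<close>, the
    second pushes its conclusion below \<open>e\<close>. The summands 1 in \<open>L\<close> keep the
    denominators positive.\<close>
  define d where "d = min (1 / (2 * L)) (e / (4 * L * (B + 1)))"
  have B0: "B \<ge> 0" by (simp add: B_def)
  have "d > 0" using L e B0 by (simp add: d_def)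
  have "dist (some_inv (1 - w *\<^sub>C b)) (some_inv (1 - z *\<^sub>C b)) < e"
    if w: "w \<in> S" "dist w z < d" for w
  proof -
    have diff: "(1 - z *\<^sub>C b) - (1 - w *\<^sub>C b) = (w - z) *\<^sub>C b" by (simp add: scaleC_diff_left)
    have n: "norm ((1 - z *\<^sub>C b) - (1 - w *\<^sub>C b)) * (B + 1) \<le> d * L"
    proof -
      have "cmod (w - z) * norm b \<le> d * (norm b + 1)"
        using w \<open>d > 0\<close> by (intro mult_mono) (auto simp: dist_norm)
      from mult_right_mono[OF this, of "B + 1"] show ?thesis
        using B0 by (simp add: diff norm_scaleC L_def mult.assoc)
    qed
    have "d * L \<le> 1 / (2 * L) * L" using L by (intro mult_right_mono) (auto simp: d_def)
    then have dL: "d * L \<le> 1 / 2" using L by simp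
    have "d * L \<le> e / (4 * L * (B + 1)) * L" using L by (intro mult_right_mono) (auto simp: d_def)
    then have dL': "d * L \<le> e / (4 * (B + 1))" using L by simp
    have "norm ((1 - z *\<^sub>C b) - (1 - w *\<^sub>C b)) * B \<le>
        norm ((1 - z *\<^sub>C b) - (1 - w *\<^sub>C b)) * (B + 1)"
      by (intro mult_left_mono) auto
    then have "norm (some_inv (1 - w *\<^sub>C b) - some_inv (1 - z *\<^sub>C b))
        \<le> 2 * B\<^sup>2 * norm ((1 - z *\<^sub>C b) - (1 - w *\<^sub>C b))"
      unfolding B_def
      by (intro norm_inverse_diff_le some_inv inv z w) (use n dL in \<open>simp add: B_def\<close>)
    also have "\<dots> \<le> 2 * B * ((B + 1) * norm ((1 - z *\<^sub>C b) - (1 - w *\<^sub>C b)))"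
      using B0 by (simp add: power2_eq_square mult_left_mono mult_right_mono mult.assoc)
    also have "\<dots> \<le> 2 * B * (e / (4 * (B + 1)))"
      using n dL' B0 by (intro mult_left_mono) (auto simp: mult.commute)
    also have "\<dots> < e"
    proof -
      have "2 * B * e < e * (4 * (B + 1))" using e B0 add_pos_nonneg[of "e * 4" "B * (e * 2)"] by (simp add: algebra_simps)
      then show ?thesis using B0 by (simp add: pos_divide_less_eq)
    qed
    finally show ?thesis by (simp add: dist_norm)
  qed
  with \<open>d > 0\<close> show "\<exists>d>0. \<forall>x'\<in>S. dist x' z < d \<longrightarrow>
      dist (some_inv (1 - x' *\<^sub>C b)) (some_inv (1 - z *\<^sub>C b)) < e" by blast
qed

text \<open>Partial fractions: \<open>1 / (1 - x^2)\<close> is the mean of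
  \<open>1 / (1 - x)\<close> and \<open>1 / (1 + x)\<close>.\<close>

lemma resolvent_average:
  fixes x :: "'a::unital_cstar_algebra"
  assumes g: "g * (1 - x) = 1" "(1 - x) * g = 1" and h: "h * (1 + x) = 1" "(1 + x) * h = 1"
  shows "((1/2) *\<^sub>R (g + h)) * (1 - x * x) = 1" "(1 - x * x) * ((1/2) *\<^sub>R (g + h)) = 1"
proof -
  have e: "1 - x * x = (1 - x) * (1 + x)" "1 - x * x = (1 + x) * (1 - x)"
    by (simp_all add: algebra_simps)
  have "g * (1 - x * x) = 1 + x" "h * (1 - x * x) = 1 - x"
    using g h by (metis e mult.assoc mult_1_left)+
  then have "(g + h) * (1 - x * x) = (2::real) *\<^sub>R 1" by (simp add: distrib_right scaleR_2)
  then show "((1/2) *\<^sub>R (g + h)) * (1 - x * x) = 1" by simp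
  have "(1 - x * x) * g = 1 + x" "(1 - x * x) * h = 1 - x"
    using g h by (metis e mult.assoc mult_1_right)+
  then have "(1 - x * x) * (g + h) = (2::real) *\<^sub>R 1" by (simp add: distrib_left scaleR_2)
  then show "(1 - x * x) * ((1/2) *\<^sub>R (g + h)) = 1" by simp
qed

lemma scaleC_power: "(c *\<^sub>C x) ^ n = c ^ n *\<^sub>C (x::'a::unital_cstar_algebra) ^ n"
  by (induction n) (simp_all add: scaleC_one scaleC_mult_left scaleC_mult_right scaleC_scaleC
      mult.commute)

text \<open>Rickart's argument: averaging the resolvent over the \<open>2 ^ k\<close>-th roots of unity gives
  the resolvent of the power \<open>b ^ 2 ^ k\<close> without changing the modulus of continuity, so
  these resolvents cannot jump, uniformly in \<open>k\<close>, when the circle of radius \<open>norm b\<close> is crossed.\<close>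

lemma resolvents_of_powers_equicontinuous:
  fixes b :: "'a::unital_cstar_algebra"
  assumes inv: "\<And>z. cmod z \<le> r \<Longrightarrow> has_inv (1 - z *\<^sub>C b)" and e: "e > 0"
  obtains d where "d > 0"
    "\<And>k. \<exists>G. (\<forall>z. cmod z \<le> r \<longrightarrow>
          G z * (1 - (z *\<^sub>C b) ^ (2 ^ k)) = 1 \<and> (1 - (z *\<^sub>C b) ^ (2 ^ k)) * G z = 1) \<and>
        (\<forall>z w. cmod z \<le> r \<longrightarrow> cmod w \<le> r \<longrightarrow> cmod (z - w) < d \<longrightarrow> norm (G z - G w) \<le> e)"
proof -
  define F where "F = (\<lambda>z. some_inv (1 - z *\<^sub>C b))"
  have "uniformly_continuous_on (cball 0 r) F"
    unfolding F_def
    by (intro compact_uniformly_continuous continuous_on_resolvent inv compact_cball) auto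
  then obtain d where d: "d > 0"
    "\<And>z w. cmod z \<le> r \<Longrightarrow> cmod w \<le> r \<Longrightarrow> cmod (z - w) < d \<Longrightarrow> norm (F z - F w) < e"
    using e unfolding uniformly_continuous_on_def by (force simp: dist_norm)
  have "\<exists>G. (\<forall>z. cmod z \<le> r \<longrightarrow>
          G z * (1 - (z *\<^sub>C b) ^ (2 ^ k)) = 1 \<and> (1 - (z *\<^sub>C b) ^ (2 ^ k)) * G z = 1) \<and>
        (\<forall>z w. cmod z \<le> r \<longrightarrow> cmod w \<le> r \<longrightarrow> cmod (z - w) < d \<longrightarrow> norm (G z - G w) \<le> e)" for k
  proof (induction k)
    case 0
    show ?case
      by (rule exI[of _ F]) (use d(2) some_inv[OF inv] in \<open>auto simp: F_def less_imp_le\<close>)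
  next
    case (Suc k)
    then obtain G where G: "\<And>z. cmod z \<le> r \<Longrightarrow> G z * (1 - (z *\<^sub>C b) ^ (2 ^ k)) = 1"
      "\<And>z. cmod z \<le> r \<Longrightarrow> (1 - (z *\<^sub>C b) ^ (2 ^ k)) * G z = 1"
      "\<And>z w. cmod z \<le> r \<Longrightarrow> cmod w \<le> r \<Longrightarrow> cmod (z - w) < d \<Longrightarrow> norm (G z - G w) \<le> e"
      by blast
    \<comment> \<open>Since \<open>u ^ (2 ^ k) = - 1\<close>, passing from \<open>z\<close> to
      \<open>u * z\<close> flips the sign of the power, so \<open>G z\<close> and
      \<open>G (u * z)\<close> are the two terms of \<open>resolvent_average\<close>. As
      \<open>u\<close> has modulus 1, the disc and all distances are preserved.\<close>
    define u where "u = cis (pi / 2 ^ k)"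
    have u: "u ^ (2 ^ k) = - 1" "cmod u = 1"
      using Complex.DeMoivre[of "pi / 2 ^ k" "2 ^ k"] by (simp_all add: u_def)
    define H where "H = (\<lambda>z. (1/2) *\<^sub>R (G z + G (u * z)))"
    have uz: "((u * z) *\<^sub>C b) ^ (2 ^ k) = - ((z *\<^sub>C b) ^ (2 ^ k))" for z
      by (simp add: scaleC_power power_mult_distrib u scaleC_minus_left)
    have sq: "(z *\<^sub>C b) ^ (2 ^ Suc k) = (z *\<^sub>C b) ^ (2 ^ k) * (z *\<^sub>C b) ^ (2 ^ k)" for z
      by (simp add: power_add[symmetric] mult_2)
    show ?case
    proof (intro exI[of _ H] conjI allI impI)
      fix z assume z: "cmod z \<le> r"
      have uz': "cmod (u * z) \<le> r" using z u by (simp add: norm_mult)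
      note h = G(1,2)[OF uz', unfolded uz minus_minus diff_minus_eq_add]
      show "H z * (1 - (z *\<^sub>C b) ^ (2 ^ Suc k)) = 1" "(1 - (z *\<^sub>C b) ^ (2 ^ Suc k)) * H z = 1"
        unfolding H_def sq using resolvent_average[OF G(1,2)[OF z] h] by auto
    next
      fix z w assume zw: "cmod z \<le> r" "cmod w \<le> r" "cmod (z - w) < d"
      have "cmod (u * z - u * w) < d" using zw u by (simp add: norm_mult flip: right_diff_distrib)
      then have "norm (G (u * z) - G (u * w)) \<le> e"
        using zw u by (intro G(3)) (auto simp: norm_mult)
      moreover have "norm (G z - G w) \<le> e" using zw by (intro G(3))
      moreover have "H z - H w = (1/2) *\<^sub>R ((G z - G w) + (G (u * z) - G (u * w)))"
        by (simp add: H_def algebra_simps)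
      ultimately show "norm (H z - H w) \<le> e"
        using norm_triangle_ineq[of "G z - G w" "G (u * z) - G (u * w)"] by simp
    qed
  qed
  with d(1) that show ?thesis by blast
qed

text \<open>Real \<open>s\<close> suffice because nonreal points are never spectral. If
  \<open>norm b\<close> exceeded \<open>t\<close>, then \<open>1 - z *\<^sub>C b\<close> would be
  invertible on a disc reaching beyond the radius \<open>1 / norm b\<close>. At a real point just
  inside that radius the high powers of \<open>z *\<^sub>C b\<close> are small and their resolvents
  close to 1; just outside, the powers have norm above 1, which keeps the resolvents away from 1.
  Equicontinuity forbids such a jump.\<close>

lemma norm_self_adjoint_le:
  fixes b :: "'a::unital_cstar_algebra"
  assumes sa: "star b = b" and t: "t \<ge> 0"
    and inv: "\<And>s::real. \<bar>s\<bar> > t \<Longrightarrow> has_inv (b - s *\<^sub>R 1)"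
  shows "norm b \<le> t"
proof (rule ccontr)
  assume "\<not> norm b \<le> t"
  then obtain s where s: "t < s" "s < norm b" using dense[of t "norm b"] by auto
  define N where "N = norm b"
  define r where "r = 1 / s"
  have pos: "s > 0" "N > 0" using s t by (auto simp: N_def)
  have rN: "1 / N < r" using s pos unfolding r_def N_def by (intro divide_strict_left_mono) auto
  have "has_inv (1 - z *\<^sub>C b)" if z: "cmod z \<le> r" for z
  proof (cases "z = 0")
    case False
    have "s \<le> cmod (1 / z)"
      using z pos False unfolding r_def norm_divide norm_one by (simp add: pos_le_divide_eq mult.commute)
    have "has_inv (b - (1 / z) *\<^sub>C 1)"
    proof (cases "Im (1 / z) = 0")
      case True
      then have "1 / z = complex_of_real (Re (1 / z))" by (simp add: complex_eq_iff)
      moreover from this have "\<bar>Re (1 / z)\<bar> > t"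
        using \<open>s \<le> cmod (1 / z)\<close> s by (metis norm_of_real less_le_trans)
      ultimately show ?thesis using inv[of "Re (1 / z)"] by (metis scaleC_of_real)
    qed (rule has_inv_self_adjoint_nonreal[OF sa])
    then have "has_inv ((- z) *\<^sub>C (b - (1 / z) *\<^sub>C 1))" using False by (intro has_inv_scaleC) auto
    moreover have "(- z) *\<^sub>C (b - (1 / z) *\<^sub>C 1) = 1 - z *\<^sub>C b"
      using False by (simp add: scaleC_diff_right scaleC_minus_left scaleC_scaleC scaleC_one)
    ultimately show ?thesis by simp
  qed simp
  then obtain d where d: "d > 0"
    "\<And>k. \<exists>G. (\<forall>z. cmod z \<le> r \<longrightarrow>
          G z * (1 - (z *\<^sub>C b) ^ (2 ^ k)) = 1 \<and> (1 - (z *\<^sub>C b) ^ (2 ^ k)) * G z = 1) \<and>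
        (\<forall>z w. cmod z \<le> r \<longrightarrow> cmod w \<le> r \<longrightarrow> cmod (z - w) < d \<longrightarrow> norm (G z - G w) \<le> 1/4)"
    using resolvents_of_powers_equicontinuous[of r b "1/4"] by auto
  \<comment> \<open>The points \<open>1 / N - h\<close> and \<open>1 / N + h\<close> must have
    distance below \<open>d\<close>, lie in the disc of radius \<open>r\<close> and be nonnegative:
    one entry of the minimum for each demand.\<close>
  define h where "h = min (min (d / 3) (r - 1 / N)) (1 / N)"
  have h: "h > 0" "h \<le> d / 3" "h \<le> r - 1 / N" "h \<le> 1 / N"
    using d(1) rN pos by (simp_all add: h_def min_le_iff_disj del: le_divide_eq_numeral1)
  define m where "m = 1 / N - h"
  define M where "M = 1 / N + h"
  have m0: "0 \<le> m" using h by (simp add: m_def)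
  have M0: "0 \<le> M" using h pos by (simp add: M_def)
  have mr: "cmod (complex_of_real m) \<le> r" "cmod (complex_of_real M) \<le> r"
    unfolding norm_of_real using h rN m0 pos by (auto simp: m_def M_def)
  have mM: "cmod (complex_of_real M - complex_of_real m) < d"
    unfolding of_real_diff[symmetric] norm_of_real using h d by (simp add: m_def M_def)
  have mN: "m * N < 1" "1 < M * N" using h pos by (simp_all add: m_def M_def left_diff_distrib distrib_right)
  have "(\<lambda>k. (m * N) ^ k) \<longlonglongrightarrow> 0"
    using mN m0 pos by (intro LIMSEQ_realpow_zero) auto
  \<comment> \<open>With \<open>norm x \<le> 1/5\<close> the relation \<open>g - 1 = g * x\<close>
    yields \<open>norm (g - 1) \<le> 1/4\<close>. Adding the oscillation \<open>1/4\<close> gives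
    \<open>norm (g' - 1) \<le> 1/2\<close>, which forces \<open>norm y \<le> 1\<close>.\<close>
  from order_tendstoD(2)[OF this, of "1/5"]
  obtain K where K: "\<And>k. k \<ge> K \<Longrightarrow> (m * N) ^ k < 1/5"
    by (auto simp: eventually_sequentially)
  obtain G where G: "\<And>z. cmod z \<le> r \<Longrightarrow> G z * (1 - (z *\<^sub>C b) ^ (2 ^ K)) = 1"
      "\<And>z w. cmod z \<le> r \<Longrightarrow> cmod w \<le> r \<Longrightarrow> cmod (z - w) < d \<Longrightarrow> norm (G z - G w) \<le> 1/4"
    using d(2)[of K] by blast
  define x where "x = (complex_of_real m *\<^sub>C b) ^ (2 ^ K)"
  define y where "y = (complex_of_real M *\<^sub>C b) ^ (2 ^ K)"
  define g where "g = G (complex_of_real m)"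
  define g' where "g' = G (complex_of_real M)"
  have "norm x = (m * N) ^ (2 ^ K)"
    using m0 norm_power_self_adjoint[OF sa, of K]
    by (simp add: x_def scaleC_power norm_scaleC norm_power N_def power_mult_distrib)
  then have nx: "norm x \<le> 1/5" using K[of "2 ^ K"] by (simp add: less_imp_le)
  have "norm y = (M * N) ^ (2 ^ K)"
    using M0 norm_power_self_adjoint[OF sa, of K]
    by (simp add: y_def scaleC_power norm_scaleC norm_power N_def power_mult_distrib)
  then have ny: "norm y > 1" using mN by (simp add: one_less_power)
  have g: "g * (1 - x) = 1" "g' * (1 - y) = 1" and gg: "norm (g' - g) \<le> 1/4"
    using G mr mM by (auto simp: g_def g'_def x_def y_def)
  have e: "g - 1 = g * x" using g(1) by (simp add: algebra_simps)
  then have n1: "norm (g - 1) \<le> norm g * (1/5)"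
    using order_trans[OF norm_mult_ineq mult_left_mono[OF nx]] by (metis norm_ge_zero)
  have "norm g \<le> 1 + norm (g - 1)"
    using norm_triangle_sub[of g 1] norm_one_le[where 'a='a] by simp
  with n1 have "norm (g - 1) \<le> 1/4" by simp
  then have "norm (g' - 1) \<le> 1/2" using gg norm_triangle_ineq[of "g' - g" "g - 1"] by simp
  moreover have "y = (g' - 1) - (g' - 1) * y" using g(2) by (simp add: algebra_simps)
  then have "norm y \<le> norm (g' - 1) + norm (g' - 1) * norm y"
    by (metis add_left_mono norm_mult_ineq norm_triangle_ineq4 order_trans)
  ultimately have "norm y \<le> 1/2 + 1/2 * norm y"
    using mult_right_mono[of "norm (g' - 1)" "1/2" "norm y"] by simp
  then show False using ny by simp
qed

subsection \<open>Positivity\<close>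

text \<open>The shifts by \<open>t > 0\<close> test the negative real axis; nonreal points are
  excluded by \<open>has_inv_self_adjoint_nonreal\<close>.\<close>

lemma cstar_pos_iff:
  "cstar_pos a \<longleftrightarrow> star a = a \<and> (\<forall>t>0. has_inv (a + t *\<^sub>R 1))"
proof -
  have spec: "c \<in> cstar_spectrum a \<longleftrightarrow> \<not> has_inv (a - c *\<^sub>C 1)" for c
    by (simp add: cstar_spectrum_def has_inv_def)
  have neg: "a + t *\<^sub>R 1 = a - complex_of_real (- t) *\<^sub>C 1" for t
    unfolding scaleC_of_real by simp
  show ?thesis
  proof (intro iffI conjI allI impI)
    fix t :: real assume "cstar_pos a" "t > 0"
    then have "complex_of_real (- t) \<notin> cstar_spectrum a"
      by (auto simp: cstar_pos_def subset_iff complex_nonneg_Reals_iff)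
    then show "has_inv (a + t *\<^sub>R 1)" by (simp only: spec neg not_not)
  next
    assume h: "star a = a \<and> (\<forall>t>0. has_inv (a + t *\<^sub>R 1))"
    have "c \<in> \<real>\<^sub>\<ge>\<^sub>0" if "c \<in> cstar_spectrum a" for c
    proof (rule ccontr)
      assume c: "c \<notin> \<real>\<^sub>\<ge>\<^sub>0"
      show False
      proof (cases "Im c = 0")
        case True
        then have "c = complex_of_real (- (- Re c))" "- Re c > 0"
          using c by (auto simp: complex_eq_iff complex_nonneg_Reals_iff)
        then show False using h that neg spec by metis
      next
        case False
        then show False using h that spec has_inv_self_adjoint_nonreal by blast
      qed
    qed
    then show "cstar_pos a" using h by (auto simp: cstar_pos_def)
  qed (simp add: cstar_pos_def)
qed

lemma cstar_posD: "cstar_pos a \<Longrightarrow> star a = a" "cstar_pos a \<Longrightarrow> t > 0 \<Longrightarrow> has_inv (a + t *\<^sub>R 1)"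
  by (auto simp: cstar_pos_iff)

text \<open>Each of the two inequalities frees one of the half-lines beyond \<open>t\<close> and
  \<open>- t\<close> from spectrum; \<open>norm_self_adjoint_le\<close> turns this into a norm
  bound.\<close>

lemma norm_le_if_order:
  fixes a :: "'a::unital_cstar_algebra"
  assumes sa: "star a = a" and t: "t \<ge> 0"
    and upper: "cstar_pos (t *\<^sub>R 1 - a)" and lower: "cstar_pos (t *\<^sub>R 1 + a)"
  shows "norm a \<le> t"
proof (rule norm_self_adjoint_le[OF sa t])
  fix s :: real assume s: "\<bar>s\<bar> > t"
  show "has_inv (a - s *\<^sub>R 1)"
  proof (cases "s > 0")
    case True
    have "- (a - s *\<^sub>R 1) = (t *\<^sub>R 1 - a) + (s - t) *\<^sub>R 1" by (simp add: algebra_simps)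
    then show ?thesis
      using cstar_posD(2)[OF upper, of "s - t"] s True by (metis abs_of_pos diff_gt_0_iff_gt has_inv_minus_iff)
  next
    case False
    have eq: "a - s *\<^sub>R 1 = (t *\<^sub>R 1 + a) + (- s - t) *\<^sub>R 1" by (simp add: algebra_simps)
    show ?thesis unfolding eq using s False by (intro cstar_posD(2)[OF lower]) simp
  qed
qed

text \<open>The disc of radius \<open>t\<close> around \<open>t\<close> misses the negative
  half-line. Together with the converse \<open>norm_diff_le_if_cstar_pos\<close> this makes
  positivity a norm condition, and closure under sums and limits a matter of the triangle
  inequality.\<close>

lemma cstar_pos_if_norm_le:
  fixes a :: "'a::unital_cstar_algebra"
  assumes sa: "star a = a" and le: "norm (t *\<^sub>R 1 - a) \<le> t"
  shows "cstar_pos a"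
  unfolding cstar_pos_iff
proof (intro conjI allI impI sa)
  fix s :: real assume s: "s > 0"
  have "- (a + s *\<^sub>R 1) = (t *\<^sub>R 1 - a) - (t + s) *\<^sub>R 1" by (simp add: algebra_simps)
  moreover have "has_inv ((t *\<^sub>R 1 - a) - (t + s) *\<^sub>R 1)"
    using le s by (intro has_inv_diff_scaleR) linarith
  ultimately show "has_inv (a + s *\<^sub>R 1)" by (metis has_inv_minus_iff)
qed

lemma cstar_pos_norm_diff: "star a = a \<Longrightarrow> norm a \<le> t \<Longrightarrow> cstar_pos (t *\<^sub>R 1 - a)"
  by (rule cstar_pos_if_norm_le[of _ t]) (simp_all add: star_diff star_scaleR)

text \<open>Since \<open>a\<close> lies between 0 and \<open>2 * t\<close>, the difference
  \<open>t - a\<close> lies between \<open>- t\<close> and \<open>t\<close>.\<close>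

lemma norm_diff_le_if_cstar_pos:
  fixes a :: "'a::unital_cstar_algebra"
  assumes pos: "cstar_pos a" and le: "norm a \<le> t"
  shows "norm (t *\<^sub>R 1 - a) \<le> t"
proof (rule norm_le_if_order)
  have sa: "star a = a" and t: "t \<ge> 0"
    using pos le norm_ge_zero[of a] by (auto simp: cstar_pos_iff simp del: norm_ge_zero)
  show "star (t *\<^sub>R 1 - a) = t *\<^sub>R 1 - a" "t \<ge> 0" using sa t by (simp_all add: star_diff star_scaleR)
  show "cstar_pos (t *\<^sub>R 1 - (t *\<^sub>R 1 - a))" using pos by simp
  have "cstar_pos ((2 * t) *\<^sub>R 1 - a)" using sa le t by (intro cstar_pos_norm_diff) auto
  then show "cstar_pos (t *\<^sub>R 1 + (t *\<^sub>R 1 - a))" by (simp add: scaleR_2 add_diff_eq flip: scaleR_scaleR)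
qed

lemma cstar_pos_add:
  fixes a b :: "'a::unital_cstar_algebra"
  assumes "cstar_pos a" "cstar_pos b" shows "cstar_pos (a + b)"
proof (rule cstar_pos_if_norm_le[of _ "norm a + norm b"])
  show "star (a + b) = a + b" using assms by (simp add: cstar_posD star_add)
  have "(norm a + norm b) *\<^sub>R 1 - (a + b) = (norm a *\<^sub>R 1 - a) + (norm b *\<^sub>R 1 - b)"
    by (simp add: algebra_simps)
  then show "norm ((norm a + norm b) *\<^sub>R 1 - (a + b)) \<le> norm a + norm b"
    using norm_diff_le_if_cstar_pos[OF assms(1) order_refl]
      norm_diff_le_if_cstar_pos[OF assms(2) order_refl] norm_triangle_le by (metis add_mono)
qed

lemma cstar_pos_zero [simp]: "cstar_pos 0"
  by (rule cstar_pos_if_norm_le[of _ 0]) simp_all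

lemma cstar_pos_one [simp]: "cstar_pos 1"
  by (rule cstar_pos_if_norm_le[of _ 1]) simp_all

lemma cstar_pos_sum: "(\<And>i. i \<in> I \<Longrightarrow> cstar_pos (f i)) \<Longrightarrow> cstar_pos (\<Sum>i\<in>I. f i)"
  by (induction I rule: infinite_finite_induct) (simp_all add: cstar_pos_add)

lemma cstar_pos_scaleR:
  fixes a :: "'a::unital_cstar_algebra"
  assumes "cstar_pos a" "r \<ge> 0" shows "cstar_pos (r *\<^sub>R a)"
proof (rule cstar_pos_if_norm_le[of _ "r * norm a"])
  show "star (r *\<^sub>R a) = r *\<^sub>R a" using assms by (simp add: cstar_posD star_scaleR)
  have "(r * norm a) *\<^sub>R 1 - r *\<^sub>R a = r *\<^sub>R (norm a *\<^sub>R 1 - a)" by (simp add: algebra_simps)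
  then show "norm ((r * norm a) *\<^sub>R 1 - r *\<^sub>R a) \<le> r * norm a"
    using norm_diff_le_if_cstar_pos[OF assms(1) order_refl] assms(2) by (simp add: mult_left_mono)
qed

text \<open>In the norm criterion the radius \<open>norm z + norm c\<close> serves all shifts with
  \<open>d \<le> 1\<close> at once, so \<open>d\<close> may tend to 0 while the radius stays
  fixed.\<close>

lemma cstar_pos_limit:
  fixes z c :: "'a::unital_cstar_algebra"
  assumes pos: "\<And>d. d > 0 \<Longrightarrow> cstar_pos (z + d *\<^sub>R c)" and sa: "star z = z"
  shows "cstar_pos z"
proof (rule cstar_pos_if_norm_le[OF sa])
  let ?t = "norm z + norm c"
  show "norm (?t *\<^sub>R 1 - z) \<le> ?t"
  proof (rule field_le_epsilon)
    fix e :: real assume e: "e > 0"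
    define d where "d = min 1 (e / (norm c + 1))"
    have d: "d > 0" "d \<le> 1" using e by (auto simp: d_def add_nonneg_pos)
    have "d * norm c \<le> e / (norm c + 1) * (norm c + 1)"
      by (intro mult_mono) (use e in \<open>auto simp: d_def\<close>)
    then have dc: "d * norm c \<le> e" by (simp add: add_nonneg_eq_0_iff)
    have "norm (z + d *\<^sub>R c) \<le> norm z + d * norm c"
      using norm_triangle_ineq[of z "d *\<^sub>R c"] d by simp
    also have "\<dots> \<le> ?t" using d by (simp add: mult_left_le_one_le)
    finally have "norm (?t *\<^sub>R 1 - (z + d *\<^sub>R c)) \<le> ?t"
      by (rule norm_diff_le_if_cstar_pos[OF pos[OF d(1)]])
    moreover have "?t *\<^sub>R 1 - z = (?t *\<^sub>R 1 - (z + d *\<^sub>R c)) + d *\<^sub>R c" by simp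
    ultimately show "norm (?t *\<^sub>R 1 - z) \<le> ?t + e"
      using norm_triangle_ineq[of "?t *\<^sub>R 1 - (z + d *\<^sub>R c)" "d *\<^sub>R c"] dc d by simp
  qed
qed

lemma norm_mono_cstar_pos:
  fixes u v :: "'a::unital_cstar_algebra"
  assumes "cstar_pos u" "cstar_pos (v - u)" shows "norm u \<le> norm v"
proof (rule norm_le_if_order)
  have v: "cstar_pos v" using cstar_pos_add[OF assms] by simp
  have "cstar_pos ((norm v *\<^sub>R 1 - v) + (v - u))"
    using v assms by (intro cstar_pos_add cstar_pos_norm_diff) (auto simp: cstar_posD)
  then show "cstar_pos (norm v *\<^sub>R 1 - u)" by simp
  show "cstar_pos (norm v *\<^sub>R 1 + u)"
    using assms by (intro cstar_pos_add cstar_pos_scaleR) auto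
qed (use assms in \<open>auto simp: cstar_posD\<close>)

lemma cstar_pos_antisym:
  fixes a :: "'a::unital_cstar_algebra"
  assumes "cstar_pos a" "cstar_pos (- a)" shows "a = 0"
  using norm_le_if_order[of a 0] assms by (simp add: cstar_posD)

text \<open>\<open>a^2 + t\<close> factors as \<open>(a - i sqrt t) * (a + i sqrt t)\<close>, and
  both factors are nonreal shifts of a self-adjoint element.\<close>

lemma cstar_pos_square_self_adjoint:
  fixes a :: "'a::unital_cstar_algebra"
  assumes sa: "star a = a" shows "cstar_pos (a * a)"
  unfolding cstar_pos_iff
proof (intro conjI allI impI)
  show "star (a * a) = a * a" by (simp add: star_mult sa)
  fix t :: real assume t: "t > 0"
  define c where "c = \<i> * complex_of_real (sqrt t)"
  have c: "c * c = complex_of_real (- t)" "Im c \<noteq> 0"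
    using t by (auto simp: c_def complex_eq_iff)
  have "(a - c *\<^sub>C 1) * (a - (- c) *\<^sub>C 1) = a * a - (c * c) *\<^sub>C 1"
    by (simp add: algebra_simps scaleC_mult_left scaleC_mult_right scaleC_scaleC scaleC_minus_left
        scaleC_diff_right)
  also have "\<dots> = a * a + t *\<^sub>R 1" unfolding c scaleC_of_real by simp
  finally show "has_inv (a * a + t *\<^sub>R 1)"
    using has_inv_mult has_inv_self_adjoint_nonreal[OF sa] c(2)
    by (metis neg_equal_0_iff_equal uminus_complex.simps(2))
qed

text \<open>The elements \<open>star v * v\<close> and \<open>v * star v\<close> have the same nonzero spectrum, and their sum
  is twice a sum of two squares; hence an upper bound for one of them bounds the norm of both.\<close>

lemma norm_square_le_if_star_mult_le:
  fixes v :: "'a::unital_cstar_algebra"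
  assumes pos: "cstar_pos (c *\<^sub>R 1 - star v * v)" and c: "c \<ge> 0"
  shows "(norm v)\<^sup>2 \<le> c"
proof -
  define p where "p = v + star v"
  define q where "q = \<i> *\<^sub>C (v - star v)"
  have sa: "star p = p" "star q = q"
    by (simp_all add: p_def q_def star_add star_scaleC star_diff star_star add.commute
        scaleC_minus_left flip: scaleC_minus_right)
  have "p * p + q * q = (2::real) *\<^sub>R (v * star v + star v * v)"
  proof -
    have "q * q = - ((v - star v) * (v - star v))"
      by (simp add: q_def scaleC_mult_left scaleC_mult_right scaleC_scaleC scaleC_minus_left scaleC_one)
    then show ?thesis by (simp add: p_def scaleR_2 algebra_simps)
  qed
  then have "v * star v + star v * v = (1/2) *\<^sub>R (p * p + q * q)" by simp
  moreover have "cstar_pos ((1/2) *\<^sub>R (p * p + q * q))"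
    using sa by (intro cstar_pos_scaleR cstar_pos_add cstar_pos_square_self_adjoint) auto
  ultimately have pp: "cstar_pos (v * star v + star v * v)" by simp
  \<comment> \<open>From \<open>v * star v \<ge> - (star v * v) \<ge> - c\<close>. This settles
    negative \<open>s\<close>; for \<open>s > c\<close> invertibility is transported from
    \<open>star v * v\<close> by swapping the factors.\<close>
  have lower: "cstar_pos (v * star v + c *\<^sub>R 1)"
    using cstar_pos_add[OF pp pos] by (simp add: algebra_simps)
  have "norm (v * star v) \<le> c"
  proof (rule norm_self_adjoint_le[OF _ c])
    show "star (v * star v) = v * star v" by (simp add: star_mult star_star)
    fix s :: real assume s: "\<bar>s\<bar> > c"
    show "has_inv (v * star v - s *\<^sub>R 1)"
    proof (cases "s > 0")
      case True
      have "has_inv ((c *\<^sub>R 1 - star v * v) + (s - c) *\<^sub>R 1)"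
        using cstar_posD(2)[OF pos, of "s - c"] s True by simp
      then have "has_inv (complex_of_real (inverse s) *\<^sub>C (s *\<^sub>R 1 - star v * v))"
        using True by (intro has_inv_scaleC) (simp_all add: algebra_simps)
      then have "has_inv (1 - (inverse s *\<^sub>R star v) * v)"
        using True unfolding scaleC_of_real by (simp add: scaleR_diff_right)
      then have "has_inv (1 - v * (inverse s *\<^sub>R star v))" by (rule has_inv_one_minus_mult_swap)
      then have "has_inv (complex_of_real (- s) *\<^sub>C (1 - v * (inverse s *\<^sub>R star v)))"
        using True by (intro has_inv_scaleC) simp_all
      then show ?thesis using True unfolding scaleC_of_real by (simp add: scaleR_diff_right)
    next
      case False
      have eq: "v * star v - s *\<^sub>R 1 = (v * star v + c *\<^sub>R 1) + (- s - c) *\<^sub>R 1"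
        by (simp add: algebra_simps)
      show ?thesis unfolding eq using s False by (intro cstar_posD(2)[OF lower]) simp
    qed
  qed
  then show ?thesis by (simp add: norm_mult_star)
qed

text \<open>Let \<open>b = star v * v\<close>. Since \<open>b (b + T)\<^sup>-\<^sup>2 \<le> 1 / (4 T)\<close>, the preceding bound applies to
  \<open>v (b + T)\<^sup>-\<^sup>1\<close>. The resulting estimate propagates invertibility from \<open>b + T\<close> to \<open>b + t\<close> for
  all \<open>t \<in> {T / 2<..T}\<close>, hence by iteration to all \<open>t > 0\<close>.\<close>

lemma norm_inverse_shifted_star_mult_le:
  fixes v :: "'a::unital_cstar_algebra"
  assumes T: "T > 0" and r: "(star v * v + T *\<^sub>R 1) * r = 1" "r * (star v * v + T *\<^sub>R 1) = 1"
  shows "norm r \<le> 2 / T"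
proof -
  define b where "b = star v * v"
  define s where "s = b + T *\<^sub>R 1"
  have sb: "star b = b" by (simp add: b_def star_mult star_star)
  have rs: "s * r = 1" "r * s = 1" using r by (simp_all add: s_def b_def)
  have sr: "star r = r"
    by (rule inverse_self_adjoint[OF _ rs]) (simp add: s_def star_add star_scaleR sb)
  have bs: "b = s - T *\<^sub>R 1" by (simp add: s_def)
  have rb: "r * b = 1 - T *\<^sub>R r" "b * r = 1 - T *\<^sub>R r"
    by (simp_all add: bs rs algebra_simps)
  have rbr: "r * b * r = r - T *\<^sub>R (r * r)" by (simp add: rb algebra_simps)
  \<comment> \<open>Completing the square: \<open>r * b * r\<close> equals \<open>r - T r^2\<close>,
    and \<open>1 / (4 T)\<close> minus this is \<open>(1 - 2 T r)^2 / (4 T)\<close>.\<close>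
  define d where "d = 1 - (2 * T) *\<^sub>R r"
  have "star d = d" by (simp add: d_def star_diff star_scaleR sr)
  then have "cstar_pos ((1 / (4 * T)) *\<^sub>R (d * d))"
    using T by (intro cstar_pos_scaleR cstar_pos_square_self_adjoint) auto
  moreover have "(1 / (4 * T)) *\<^sub>R (d * d) = (1 / (4 * T)) *\<^sub>R 1 - star (v * r) * (v * r)"
  proof -
    have "star (v * r) * (v * r) = r * b * r" by (simp add: star_mult sr b_def mult.assoc)
    moreover have "d * d = 1 - (4 * T) *\<^sub>R (r - T *\<^sub>R (r * r))"
      by (simp add: d_def algebra_simps) (simp add: scaleR_2 flip: scaleR_add_left)
    ultimately show ?thesis using T by (simp add: rbr scaleR_diff_right)
  qed
  ultimately have "cstar_pos ((1 / (4 * T)) *\<^sub>R 1 - star (v * r) * (v * r))" by simp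
  then have "(norm (v * r))\<^sup>2 \<le> 1 / (4 * T)"
    using T by (intro norm_square_le_if_star_mult_le) auto
  then have "norm (r * b * r) \<le> 1 / (4 * T)"
    using cstar_identity[of "v * r"] by (simp add: star_mult sr b_def mult.assoc)
  moreover have "T *\<^sub>R (r * r) = r - r * b * r" by (simp add: rbr)
  then have "norm (T *\<^sub>R (r * r)) \<le> norm r + norm (r * b * r)" by (metis norm_triangle_ineq4)
  ultimately have "T * (norm r)\<^sup>2 \<le> norm r + 1 / (4 * T)"
    using T norm_square_self_adjoint[OF sr] by simp
  then have "T * (T * (norm r)\<^sup>2) \<le> T * (norm r + 1 / (4 * T))"
    using T by (intro mult_left_mono) auto
  then have z: "(T * norm r)\<^sup>2 \<le> T * norm r + 1 / 4"
    using T by (simp add: power2_eq_square algebra_simps)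
  have "T * norm r \<le> 2"
  proof (rule ccontr)
    assume "\<not> T * norm r \<le> 2"
    then have "2 * (T * norm r) \<le> (T * norm r) * (T * norm r)" by (intro mult_right_mono) auto
    with z \<open>\<not> T * norm r \<le> 2\<close> show False by (simp add: power2_eq_square)
  qed
  then show ?thesis using T by (simp add: field_simps)
qed

text \<open>The class axioms constrain the norm of \<open>star v * v\<close> but not its spectrum,
  so positivity needs a proof. Conjugation and the Cauchy-Schwarz inequality rest on it.\<close>

theorem cstar_pos_star_mult: "cstar_pos (star v * (v::'a::unital_cstar_algebra))"
  unfolding cstar_pos_iff
proof (intro conjI allI impI)
  show "star (star v * v) = star v * v" by (simp add: star_mult star_star)
  define M where "M = norm (star v * v) + 1"
  have M: "M > 0" by (simp add: M_def add_nonneg_pos)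
  have ind: "T \<ge> M * (2/3) ^ n \<Longrightarrow> has_inv (star v * v + T *\<^sub>R 1)" for n T
  proof (induction n arbitrary: T)
    case 0
    then have "norm (star v * v) < \<bar>- T\<bar>" by (simp add: M_def)
    from has_inv_diff_scaleR[OF this] show ?case by simp
  next
    case (Suc n)
    \<comment> \<open>The inverse at \<open>S\<close> tolerates perturbations smaller than
      \<open>S / 2\<close>, and the move from \<open>S\<close> to \<open>T\<close> has size
      \<open>T / 2 = S / 3\<close>. The ratio \<open>T / S = 2/3\<close> is the factor by which the
      induction lowers the reachable shifts.\<close>
    define S where "S = 3 / 2 * T"
    have "M * (2/3) ^ Suc n > 0" using M by simp
    then have T: "T > 0" using Suc.prems by linarith
    have "has_inv (star v * v + S *\<^sub>R 1)" using Suc by (simp add: S_def)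
    then obtain r where r: "(star v * v + S *\<^sub>R 1) * r = 1" "r * (star v * v + S *\<^sub>R 1) = 1"
      by (rule has_invE)
    have "norm r \<le> 2 / S"
      using T by (intro norm_inverse_shifted_star_mult_le[OF _ r]) (simp add: S_def)
    moreover have "(star v * v + S *\<^sub>R 1) - (star v * v + T *\<^sub>R 1) = (T / 2) *\<^sub>R 1"
      by (simp add: S_def flip: scaleR_diff_left)
    then have "norm ((star v * v + S *\<^sub>R 1) - (star v * v + T *\<^sub>R 1)) \<le> T / 2"
      using norm_scaleR_one_le[of "T / 2", where 'a='a] T by simp
    ultimately have "norm ((star v * v + S *\<^sub>R 1) - (star v * v + T *\<^sub>R 1)) * norm r \<le> (T / 2) * (2 / S)"
      using T by (intro mult_mono) auto
    also have "\<dots> < 1" using T by (simp add: S_def)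
    finally show ?case by (rule has_inv_perturb[OF r])
  qed
  fix t :: real assume t: "t > 0"
  obtain n where "(2/3) ^ n < t / M" using real_arch_pow_inv[of "t / M" "2/3"] t M by auto
  then have "M * (2/3) ^ n \<le> t" using M by (simp add: pos_less_divide_eq mult.commute)
  then show "has_inv (star v * v + t *\<^sub>R 1)" by (rule ind)
qed

lemma cstar_pos_mult_star: "cstar_pos (v * star (v::'a::unital_cstar_algebra))"
  using cstar_pos_star_mult[of "star v"] by (simp add: star_star)

section \<open>Square roots, conjugation and comparison\<close>

lemma sqrt_exists:
  fixes x :: "'a::unital_cstar_algebra"
  assumes sa: "star x = x" and x: "norm x < 1"
  obtains q where "star q = q" "has_inv q" "q * q = 1 - x"
proof -
  define d where "d = 1 - norm x"
  define r where "r = 1 - d / 2"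
  have d: "0 < d" "d \<le> 1" using x by (auto simp: d_def)
  have r: "0 \<le> r" "r < 1" using d by (auto simp: r_def)
  define S where "S = {y::'a. norm y \<le> r \<and> star y = y}"
  \<comment> \<open>A fixed point satisfies \<open>2 y = x + y^2\<close>, that is
    \<open>(1 - y)^2 = 1 - x\<close>. The radius \<open>r\<close> is the midpoint of
    \<open>norm x\<close> and 1: the ball is then mapped into itself, \<open>r\<close> is also the
    contraction constant, and \<open>r < 1\<close> makes \<open>1 - y\<close> invertible.\<close>
  define f where "f = (\<lambda>y::'a. (1/2) *\<^sub>R (x + y * y))"
  have "\<exists>!y\<in>S. f y = y"
  proof (rule Banach_fix)
    have "closed S"
      unfolding S_def
      by (intro closed_Collect_conj closed_Collect_le closed_Collect_eq continuous_intros
          linear_continuous_on bounded_linear_star)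
    then show "complete S" by (simp add: complete_eq_closed)
    show "S \<noteq> {}" using r by (auto simp: S_def intro: exI[of _ 0])
    show "0 \<le> r" "r < 1" by fact+
    show "f ` S \<subseteq> S"
    proof (intro image_subsetI)
      fix y assume "y \<in> S"
      then have y: "norm y \<le> r" "star y = y" by (auto simp: S_def)
      have "norm (x + y * y) \<le> norm x + (norm y)\<^sup>2"
        using norm_triangle_ineq[of x "y * y"] norm_square_self_adjoint[OF y(2)] by simp
      also have "\<dots> \<le> norm x + r\<^sup>2" using y by (simp add: power_mono)
      also have "\<dots> = 2 * r - (d - (d / 2) * (d / 2))"
        by (simp add: r_def d_def power2_eq_square field_simps)
      also have "\<dots> \<le> 2 * r"
        using d mult_mono[of "d / 2" 1 "d / 2" d] by simp
      finally show "f y \<in> S" using sa y by (simp add: S_def f_def star_scaleR star_add star_mult)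
    qed
    fix y z assume "y \<in> S" "z \<in> S"
    then have y: "norm y \<le> r" and z: "norm z \<le> r" by (auto simp: S_def)
    have "f y - f z = (1/2) *\<^sub>R ((y - z) * y + z * (y - z))" by (simp add: f_def algebra_simps)
    moreover have "norm ((y - z) * y) \<le> norm (y - z) * r"
      using y by (rule order_trans[OF norm_mult_ineq mult_left_mono]) simp
    moreover have "norm (z * (y - z)) \<le> r * norm (y - z)"
      using z by (rule order_trans[OF norm_mult_ineq mult_right_mono]) simp
    ultimately show "dist (f y) (f z) \<le> r * dist y z"
      using norm_triangle_ineq[of "(y - z) * y" "z * (y - z)"]
      by (simp add: dist_norm mult.commute[of r])
  qed
  then obtain y where y: "norm y \<le> r" "star y = y" "f y = y" by (auto simp: S_def)
  have fy: "y + y = x + y * y"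
    using arg_cong[OF y(3), of "\<lambda>u. 2 *\<^sub>R u"] by (simp add: f_def scaleR_2)
  show thesis
  proof (rule that[of "1 - y"])
    show "star (1 - y) = 1 - y" using y by (simp add: star_diff)
    show "has_inv (1 - y)" using y r by (intro has_inv_one_minus) linarith
    have "(1 - y) * (1 - y) = 1 - (y + y) + y * y" by (simp add: algebra_simps)
    then show "(1 - y) * (1 - y) = 1 - x" by (simp add: fy)
  qed
qed

text \<open>After division by \<open>norm k + e\<close> the shifted element is \<open>1 - x\<close>
  with \<open>norm x < 1\<close>. The shift also makes the root invertible where \<open>k\<close> is
  not.\<close>

lemma sqrt_shifted_cstar_pos:
  fixes k :: "'a::unital_cstar_algebra"
  assumes k: "cstar_pos k" and e: "e > 0"
  obtains q where "star q = q" "has_inv q" "q * q = k + e *\<^sub>R 1"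
proof -
  define K where "K = norm k + e"
  have K: "K > 0" using e by (simp add: K_def add_nonneg_pos)
  define x where "x = (1 / K) *\<^sub>R (norm k *\<^sub>R 1 - k)"
  have "star x = x" using k by (simp add: x_def star_scaleR star_diff cstar_posD)
  moreover have "norm x < 1"
    using norm_diff_le_if_cstar_pos[OF k order_refl] K e by (simp add: x_def K_def)
  ultimately obtain q where q: "star q = q" "has_inv q" "q * q = 1 - x" by (rule sqrt_exists)
  show thesis
  proof (rule that[of "sqrt K *\<^sub>R q"])
    show "star (sqrt K *\<^sub>R q) = sqrt K *\<^sub>R q" by (simp add: star_scaleR q)
    show "has_inv (sqrt K *\<^sub>R q)"
      using has_inv_scaleC[OF _ q(2), of "complex_of_real (sqrt K)"] K by (simp add: scaleC_of_real)
    have "sqrt K *\<^sub>R q * sqrt K *\<^sub>R q = K *\<^sub>R (1 - x)" using K by (simp add: q)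
    also have "\<dots> = k + e *\<^sub>R 1" using K by (simp add: x_def scaleR_diff_right) (simp add: K_def algebra_simps)
    finally show "sqrt K *\<^sub>R q * sqrt K *\<^sub>R q = k + e *\<^sub>R 1" .
  qed
qed

text \<open>For \<open>z = q * q\<close> the conjugate is \<open>(c * q) * star (c * q)\<close>; a
  general \<open>z\<close> is the limit of \<open>z + d\<close>, which has such a root.\<close>

lemma cstar_pos_conjugate:
  fixes c z :: "'a::unital_cstar_algebra"
  assumes z: "cstar_pos z" shows "cstar_pos (c * z * star c)"
proof (rule cstar_pos_limit[where c = "c * star c"])
  show "star (c * z * star c) = c * z * star c"
    using z by (simp add: star_mult star_star cstar_posD mult.assoc)
  fix d :: real assume d: "d > 0"
  obtain q where q: "star q = q" "has_inv q" "q * q = z + d *\<^sub>R 1"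
    using sqrt_shifted_cstar_pos[OF z d] .
  have "c * (q * q) * star c = (c * q) * star (c * q)" by (simp add: star_mult q(1) mult.assoc)
  then have "cstar_pos (c * (q * q) * star c)" using cstar_pos_mult_star by metis
  moreover have "c * (q * q) * star c = c * z * star c + d *\<^sub>R (c * star c)"
    unfolding q(3) by (simp add: distrib_left distrib_right)
  ultimately show "cstar_pos (c * z * star c + d *\<^sub>R (c * star c))" by simp
qed

text \<open>The bridge from norm to order, used for the frame bounds and for isometries. Conjugation
  by \<open>p\<close> normalizes \<open>k\<close> to at most 1, where norm and order bounds agree;
  conjugation by \<open>q\<close> undoes this and leaves \<open>h \<le> k + e\<close>.\<close>

lemma cstar_le_if_conjugate_norm_le:
  fixes h k :: "'a::unital_cstar_algebra"
  assumes h: "star h = h" and k: "cstar_pos k"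
    and le: "\<And>a. norm (a * h * star a) \<le> norm (a * k * star a)"
  shows "cstar_pos (k - h)"
proof (rule cstar_pos_limit[where c = 1])
  show "star (k - h) = k - h" using h k by (simp add: star_diff cstar_posD)
  fix e :: real assume e: "e > 0"
  obtain q where q: "star q = q" "has_inv q" "q * q = k + e *\<^sub>R 1"
    using sqrt_shifted_cstar_pos[OF k e] .
  obtain p where p: "q * p = 1" "p * q = 1" using q(2) by (rule has_invE)
  have sp: "star p = p" using inverse_self_adjoint[OF q(1) p] .
  have "p * (q * q) * p = 1" using p by (metis mult.assoc mult_1_left)
  then have pkp: "p * k * p = 1 - e *\<^sub>R (p * p)" by (simp add: q algebra_simps)
  have "norm (p * k * p) \<le> 1"
  proof (rule norm_le_if_order)
    show "star (p * k * p) = p * k * p" using k by (simp add: star_mult sp cstar_posD mult.assoc)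
    show "cstar_pos (1 *\<^sub>R 1 - p * k * p)"
      unfolding pkp using e sp by (simp add: cstar_pos_scaleR cstar_pos_square_self_adjoint)
    show "cstar_pos (1 *\<^sub>R 1 + p * k * p)"
      using cstar_pos_conjugate[OF k, of p] sp by (simp add: cstar_pos_add)
  qed simp
  then have "norm (p * h * p) \<le> 1" using le[of p] sp by simp
  then have "cstar_pos (1 *\<^sub>R 1 - p * h * p)"
    by (intro cstar_pos_norm_diff) (simp_all add: star_mult sp h mult.assoc)
  then have "cstar_pos (q * (1 - p * h * p) * q)"
    using cstar_pos_conjugate[of "1 - p * h * p" q] q by simp
  moreover have "q * (1 - p * h * p) * q = q * q - (q * p) * h * (p * q)"
    by (simp only: right_diff_distrib left_diff_distrib mult.assoc mult_1_left mult_1_right)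
  ultimately show "cstar_pos (k - h + e *\<^sub>R 1)" by (simp add: p q algebra_simps)
qed

subsection \<open>Cauchy-Schwarz and the frame operator\<close>

text \<open>Neither definiteness nor completeness is demanded, because Cauchy-Schwarz is also
  applied to the form \<open>ip (X x) y\<close> with \<open>X = 1 - S / K\<close> for the frame
  operator \<open>S\<close>, and that form may be degenerate.\<close>

locale cstar_form =
  fixes act :: "'a::unital_cstar_algebra \<Rightarrow> 'm::complex_vector \<Rightarrow> 'm"
    and B :: "'m \<Rightarrow> 'm \<Rightarrow> 'a"
  assumes form_pos: "cstar_pos (B x x)"
    and form_star: "B x y = star (B y x)"
    and form_act_left: "B (act a x) y = a * B x y"
    and form_add_left: "B (x + y) z = B x z + B y z"
begin

lemma form_act_right: "B x (act a y) = B x y * star a"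
  by (metis form_act_left form_star star_mult)

lemma form_add_right: "B x (y + z) = B x y + B x z"
  by (metis form_add_left form_star star_add)

lemma form_zero_left [simp]: "B 0 y = 0"
  using form_add_left[of 0 0 y] by simp

lemma form_minus_left: "B (- x) y = - B x y"
  using form_add_left[of x "- x" y] by (simp add: eq_neg_iff_add_eq_0 add.commute)

lemma form_diff_left: "B (x - y) z = B x z - B y z"
  using form_add_left[of x "- y" z] by (simp add: form_minus_left)

lemma form_diff_right: "B x (y - z) = B x y - B x z"
  by (metis form_diff_left form_star star_diff)

lemma form_zero_right [simp]: "B x 0 = 0"
  using form_add_right[of x 0 0] by simp

lemma form_sum_left: "B (\<Sum>i\<in>I. f i) y = (\<Sum>i\<in>I. B (f i) y)"
  by (induction I rule: infinite_finite_induct) (simp_all add: form_add_left)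

text \<open>With \<open>k = B y y\<close>, the inequality is the positivity of \<open>B u u\<close> for
  \<open>u = x - B x y (k + e)\<^sup>-\<^sup>1 y\<close>, in the limit \<open>e \<rightarrow> 0\<close>.\<close>

lemma Cauchy_Schwarz: "(norm (B x y))\<^sup>2 \<le> norm (B x x) * norm (B y y)"
proof -
  define h where "h = B x x"
  define k where "k = B y y"
  define b where "b = B x y"
  have eps: "(norm b)\<^sup>2 \<le> norm h * (norm k + e)" if e: "e > 0" for e
  proof -
    obtain q where q: "star q = q" "has_inv q" "q * q = k + e *\<^sub>R 1"
      using sqrt_shifted_cstar_pos[OF _ e] form_pos k_def by metis
    obtain p where p: "q * p = 1" "p * q = 1" using q(2) by (rule has_invE)
    have sp: "star p = p" using inverse_self_adjoint[OF q(1) p] .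
    define a where "a = b * (p * p)"
    have byx: "B y x = star b" by (simp add: b_def form_star[symmetric])
    have sa: "star a = p * p * star b" by (simp add: a_def star_mult sp)
    have "p * (q * q) * p = 1" using p by (metis mult.assoc mult_1_left)
    then have "p * k * p = 1 - e *\<^sub>R (p * p)" by (simp add: q(3) algebra_simps)
    then have "p * (p * k * p) * p = p * (1 - e *\<^sub>R (p * p)) * p" by simp
    then have "p * (p * k * p) * p = p * p - e *\<^sub>R (p * p * (p * p))"
      by (simp add: right_diff_distrib left_diff_distrib mult.assoc)
    then have pkp: "p * (p * (k * (p * p))) = p * p - e *\<^sub>R (p * p * (p * p))"
      by (simp add: mult.assoc)
    have "B (x - act a y) (x - act a y) = h - a * star b - b * star a + a * k * star a"
      by (simp add: form_diff_left form_diff_right form_act_left form_act_right byx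
          h_def[symmetric] k_def[symmetric] b_def[symmetric] algebra_simps)
    also have "a * k * star a = b * (p * (p * (k * (p * p)))) * star b"
      by (simp add: a_def sa[unfolded a_def] mult.assoc)
    also have "\<dots> = b * (p * p) * star b - e *\<^sub>R (a * star a)"
      unfolding pkp sa by (simp add: a_def algebra_simps)
    also have "h - a * star b - b * star a + (b * (p * p) * star b - e *\<^sub>R (a * star a))
        = h - (b * p) * star (b * p) - e *\<^sub>R (a * star a)"
      by (simp add: sa) (simp add: a_def star_mult sp mult.assoc)
    finally have "cstar_pos (h - (b * p) * star (b * p) - e *\<^sub>R (a * star a))"
      using form_pos by metis
    \<comment> \<open>Adding back \<open>e *\<^sub>R (a * star a)\<close> leaves
      \<open>(b * p) * star (b * p) \<le> h\<close>. The factor \<open>p\<close> is then removed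
      through \<open>b = b * p * q\<close> and \<open>norm q ^ 2 \<le> norm k + e\<close>.\<close>
    from cstar_pos_add[OF this cstar_pos_scaleR[OF cstar_pos_mult_star[of a], of e]]
    have "cstar_pos (h - (b * p) * star (b * p))" using e by simp
    from norm_mono_cstar_pos[OF cstar_pos_mult_star this]
    have hb: "(norm (b * p))\<^sup>2 \<le> norm h" by (simp add: norm_mult_star)
    have "(norm q)\<^sup>2 = norm (k + e *\<^sub>R 1)" using norm_square_self_adjoint[OF q(1)] q(3) by simp
    also have "\<dots> \<le> norm k + e"
      using norm_triangle_ineq[of k "e *\<^sub>R 1"] norm_scaleR_one_le[of e, where 'a='a] e by linarith
    finally have hq: "(norm q)\<^sup>2 \<le> norm k + e" .
    have "b = b * p * q" by (simp add: mult.assoc p)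
    then have "norm b \<le> norm (b * p) * norm q" by (metis norm_mult_ineq)
    then have "(norm b)\<^sup>2 \<le> (norm (b * p))\<^sup>2 * (norm q)\<^sup>2"
      by (metis norm_ge_zero power_mono power_mult_distrib)
    also have "\<dots> \<le> norm h * (norm k + e)" using hb hq by (intro mult_mono) auto
    finally show ?thesis .
  qed
  show ?thesis
  proof (rule field_le_epsilon)
    fix e :: real assume e: "e > 0"
    define d where "d = e / (norm h + 1)"
    have d: "d > 0" using e by (simp add: d_def add_nonneg_pos)
    have "norm h * d \<le> (norm h + 1) * d" using d by simp
    also have "\<dots> = e" using norm_ge_zero[of h] by (simp add: d_def add_nonneg_eq_0_iff)
    finally show "(norm (B x y))\<^sup>2 \<le> norm (B x x) * norm (B y y) + e"
      using eps[OF d] by (simp add: h_def k_def b_def distrib_left)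
  qed
qed

abbreviation "nrm \<equiv> hm_norm B"

lemma nrm_nonneg [simp]: "nrm x \<ge> 0"
  by (simp add: hm_norm_def)

lemma nrm_zero [simp]: "nrm 0 = 0"
  by (simp add: hm_norm_def)

lemma nrm_square: "(nrm x)\<^sup>2 = norm (B x x)"
  by (simp add: hm_norm_def)

lemma norm_form_le: "norm (B x y) \<le> nrm x * nrm y"
  by (rule power2_le_imp_le) (simp_all add: power_mult_distrib nrm_square Cauchy_Schwarz)

lemma nrm_triangle: "nrm (x + y) \<le> nrm x + nrm y"
proof (rule power2_le_imp_le)
  have "(nrm (x + y))\<^sup>2 = norm ((B x x + B x y) + (B y x + B y y))"
    by (simp add: nrm_square form_add_left form_add_right algebra_simps)
  also have "\<dots> \<le> (norm (B x x) + norm (B x y)) + (norm (B y x) + norm (B y y))"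
    by (intro norm_triangle_mono norm_triangle_ineq)
  also have "\<dots> \<le> (nrm x + nrm y)\<^sup>2"
    using norm_form_le[of x y] norm_form_le[of y x] by (simp add: nrm_square[symmetric] power2_sum mult.commute[of "nrm y"])
  finally show "(nrm (x + y))\<^sup>2 \<le> (nrm x + nrm y)\<^sup>2" .
qed simp

lemma nrm_minus: "nrm (- x) = nrm x"
proof -
  have "B (- x) (- x) = B x x"
    using form_diff_right[of "- x" 0 x] by (simp add: form_minus_left)
  then show ?thesis by (simp add: hm_norm_def)
qed

lemma nrm_minus_commute: "nrm (x - y) = nrm (y - x)"
  using nrm_minus[of "x - y"] by simp

lemma nrm_triangle_diff: "nrm (x - z) \<le> nrm (x - y) + nrm (y - z)"
  using nrm_triangle[of "x - y" "y - z"] by simp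

end

section \<open>Completeness and bounds for the frame operator\<close>

context hilbert_module
begin

sublocale cstar_form act ip
  by unfold_locales (rule ip_pos ip_star ip_act_left ip_add_left)+

lemma nrm_eq_zero_iff [simp]: "nrm x = 0 \<longleftrightarrow> x = 0"
  by (simp add: hm_norm_def ip_eq_zero_iff)

lemma act_scaleC_one: "act (c *\<^sub>C 1) x = c *\<^sub>C x"
  by (simp add: act_scaleC_left act_one)

lemma ip_scaleC_left: "ip (c *\<^sub>C x) y = c *\<^sub>C ip x y"
  by (metis act_scaleC_one ip_act_left mult_1_left scaleC_mult_left)

lemma ip_scaleC_right: "ip x (c *\<^sub>C y) = cnj c *\<^sub>C ip x y"
  by (metis ip_scaleC_left ip_star star_scaleC)

lemma nrm_scaleC: "nrm (c *\<^sub>C x) = cmod c * nrm x"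
  by (simp add: hm_norm_def ip_scaleC_left ip_scaleC_right norm_scaleC real_sqrt_mult
      flip: mult.assoc)

lemma act_zero_right [simp]: "act a 0 = 0"
  using act_add_right[of a 0 0] by simp

lemma act_sum_right: "act a (\<Sum>i\<in>I. f i) = (\<Sum>i\<in>I. act a (f i))"
  by (induction I rule: infinite_finite_induct) (simp_all add: act_add_right)

lemma eq_if_ip_eq: "(\<And>z. ip x z = ip y z) \<Longrightarrow> x = y"
  using ip_eq_zero_iff[of "x - y"] by (simp add: form_diff_left)

text \<open>The module norm depends on the parameter \<open>ip\<close>, so Baire's theorem is
  applied to an explicit metric on \<open>UNIV\<close>. Closedness is phrased with sequences, the
  form in which it is verified later.\<close>

lemma Baire_closed_cover:
  assumes cover: "\<And>x. \<exists>m::nat. x \<in> F m"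
    and closed: "\<And>m X x. (\<And>n. X n \<in> F m) \<Longrightarrow> (\<lambda>n. nrm (X n - x)) \<longlonglongrightarrow> 0 \<Longrightarrow> x \<in> F m"
  obtains m x r where "r > 0" "\<And>y. nrm (y - x) < r \<Longrightarrow> y \<in> F m"
proof -
  interpret M: Metric_space UNIV "\<lambda>x y. nrm (x - y)"
    by unfold_locales (auto simp: nrm_minus_commute nrm_triangle_diff)
  have lim: "limitin M.mtopology X x sequentially \<longleftrightarrow> (\<lambda>n. nrm (X n - x)) \<longlonglongrightarrow> 0"
    for X :: "nat \<Rightarrow> 'm" and x
    by (simp add: M.limit_metric_sequentially lim_sequentially)
  have "M.mcomplete"
    unfolding M.mcomplete_def M.MCauchy_def lim
  proof (intro allI impI)
    fix X :: "nat \<Rightarrow> 'm" assume X: "range X \<subseteq> UNIV \<and>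
      (\<forall>e>0. \<exists>N. \<forall>n n'. N \<le> n \<longrightarrow> N \<le> n' \<longrightarrow> nrm (X n - X n') < e)"
    have "\<forall>e>0. \<exists>n0. \<forall>m\<ge>n0. \<forall>n\<ge>n0. nrm (X m - X n) < e"
    proof (intro allI impI)
      fix e :: real assume "e > 0"
      then obtain n0 where "\<And>n n'. n0 \<le> n \<Longrightarrow> n0 \<le> n' \<Longrightarrow> nrm (X n - X n') < e"
        using X by meson
      then show "\<exists>n0. \<forall>m\<ge>n0. \<forall>n\<ge>n0. nrm (X m - X n) < e" by (intro exI[of _ n0]) simp
    qed
    then show "\<exists>x. (\<lambda>n. nrm (X n - x)) \<longlonglongrightarrow> 0" by (rule complete)
  qed
  moreover have "closedin M.mtopology (F m)" for m
    unfolding M.metric_closedin_iff_sequentially_closed lim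
    using closed by (metis range_subsetD subset_UNIV)
  moreover have "M.mtopology interior_of (\<Union>(range F)) \<noteq> {}"
  proof -
    have "\<Union>(range F) = UNIV" using cover by auto
    then have "M.mtopology interior_of (\<Union>(range F)) = UNIV"
      by (metis M.topspace_mtopology interior_of_topspace)
    then show ?thesis by simp
  qed
  ultimately obtain m where "M.mtopology interior_of (F m) \<noteq> {}"
    using M.metric_Baire_category_alt[of "range F"] by auto
  then obtain x r where "r > 0" "M.mball x r \<subseteq> F m"
    unfolding ex_in_conv[symmetric] M.in_interior_of_mball by blast
  then show ?thesis
    by (intro that[of r x m]) (auto simp: nrm_minus_commute subset_iff)
qed

text \<open>Finite generation alone does not give this estimate; completeness enters through Baire's theorem.\<close>

lemma generators_norm_bound:
  assumes gen: "\<And>x. \<exists>a. x = (\<Sum>i\<in>I. act (a i) (g i))" and fin: "finite I"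
  obtains C where "C \<ge> 0" "\<And>x. nrm x \<le> C * (\<Sum>i\<in>I. norm (ip (g i) x))"
proof -
  define s where "s = (\<lambda>y. \<Sum>i\<in>I. norm (ip (g i) y))"
  have s0: "s y \<ge> 0" for y by (simp add: s_def sum_nonneg)
  \<comment> \<open>Expanding \<open>x\<close> in the generators places it in \<open>F m\<close> as
    soon as \<open>m\<close> exceeds the sum of the norms of its coefficients. The coefficients come
    without a bound in terms of \<open>nrm x\<close>; a common \<open>m\<close> for a whole ball is
    what Baire supplies.\<close>
  define F where "F = (\<lambda>m::nat. {x. \<forall>y. norm (ip x y) \<le> real m * s y})"
  have cover: "\<exists>m. x \<in> F m" for x
  proof -
    obtain a where a: "x = (\<Sum>i\<in>I. act (a i) (g i))" using gen by blast
    obtain m :: nat where m: "(\<Sum>i\<in>I. norm (a i)) \<le> real m" using real_arch_simple by blast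
    have "norm (ip x y) \<le> real m * s y" for y
    proof -
      have "norm (ip x y) \<le> (\<Sum>i\<in>I. norm (a i * ip (g i) y))"
        unfolding a form_sum_left ip_act_left by (rule norm_sum)
      also have "\<dots> \<le> (\<Sum>i\<in>I. real m * norm (ip (g i) y))"
      proof (rule sum_mono)
        fix i assume i: "i \<in> I"
        have "norm (a i) \<le> (\<Sum>i\<in>I. norm (a i))"
          using i fin by (intro member_le_sum) auto
        then have "norm (a i) * norm (ip (g i) y) \<le> real m * norm (ip (g i) y)"
          using m by (intro mult_right_mono) auto
        then show "norm (a i * ip (g i) y) \<le> real m * norm (ip (g i) y)"
          using norm_mult_ineq order_trans by blast
      qed
      finally show ?thesis by (simp add: s_def sum_distrib_left)
    qed
    then show ?thesis by (auto simp: F_def)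
  qed
  have closed: "x \<in> F m" if X: "\<And>n. X n \<in> F m" "(\<lambda>n. nrm (X n - x)) \<longlonglongrightarrow> 0" for m X x
  proof -
    have "norm (ip x y) \<le> real m * s y" for y
    proof (rule LIMSEQ_le_const)
      show "(\<lambda>n. real m * s y + nrm (X n - x) * nrm y) \<longlonglongrightarrow> real m * s y"
        using tendsto_add[OF tendsto_const tendsto_mult_left_zero[OF X(2)]] by simp
      have "norm (ip x y) \<le> real m * s y + nrm (X n - x) * nrm y" for n
      proof -
        have "ip x y = ip (X n) y - ip (X n - x) y" by (simp add: form_diff_left)
        moreover have "norm (ip (X n) y) \<le> real m * s y" using X(1) by (auto simp: F_def)
        ultimately show ?thesis
          using norm_triangle_ineq4[of "ip (X n) y" "ip (X n - x) y"] norm_form_le[of "X n - x" y]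
          by simp
      qed
      then show "\<exists>N. \<forall>n\<ge>N. norm (ip x y) \<le> real m * s y + nrm (X n - x) * nrm y" by blast
    qed
    then show ?thesis by (simp add: F_def)
  qed
  obtain m x0 r where r: "r > 0" and ball: "\<And>y. nrm (y - x0) < r \<Longrightarrow> y \<in> F m"
    using Baire_closed_cover[of F] cover closed by metis
  have "nrm x \<le> (4 * real m / r) * s x" for x
  proof (cases "x = 0")
    case True
    then show ?thesis using s0[of x] r by simp
  next
    case False
    then have nx: "nrm x > 0" using nrm_nonneg[of x] nrm_eq_zero_iff[of x] by linarith
    \<comment> \<open>Scaled to norm \<open>r / 2\<close>, the vector \<open>z\<close> keeps
      \<open>x0 + z\<close> in the ball. Subtracting the estimate for \<open>x0\<close> costs a
      factor 2, and \<open>norm (ip z x)\<close> is \<open>r / 2 * nrm x\<close>; hence the constant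
      \<open>4 m / r\<close>.\<close>
    define c where "c = r / (2 * nrm x)"
    have c: "c > 0" using r nx by (simp add: c_def)
    define z where "z = complex_of_real c *\<^sub>C x"
    have "nrm z = c * nrm x" using c by (simp add: z_def nrm_scaleC)
    then have "nrm z < r" using nx r by (simp add: c_def)
    then have "x0 + z \<in> F m" "x0 \<in> F m" using ball[of "x0 + z"] ball[of x0] r by auto
    then have "norm (ip (x0 + z) x) \<le> real m * s x" "norm (ip x0 x) \<le> real m * s x"
      by (auto simp: F_def)
    moreover have "ip z x = ip (x0 + z) x - ip x0 x" by (simp add: form_add_left)
    ultimately have "norm (ip z x) \<le> 2 * real m * s x"
      using norm_triangle_ineq4[of "ip (x0 + z) x" "ip x0 x"] by simp
    moreover have "norm (ip z x) = c * (nrm x)\<^sup>2"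
      using c by (simp add: z_def ip_scaleC_left norm_scaleC nrm_square)
    then have "norm (ip z x) = r / 2 * nrm x" using nx by (simp add: c_def power2_eq_square)
    ultimately show ?thesis using r by (simp add: field_simps)
  qed
  then show ?thesis using r by (intro that[of "4 * real m / r"]) (auto simp: s_def)
qed

lemma ip_frame_operator:
  "ip (\<Sum>i\<in>I. act (ip x (g i)) (g i)) y = (\<Sum>i\<in>I. ip x (g i) * ip (g i) y)"
  by (simp add: form_sum_left ip_act_left)

lemma cstar_pos_ip_mult_ip: "cstar_pos (ip x y * ip y x)"
  by (metis cstar_pos_mult_star ip_star)

lemma norm_ip_mult_ip: "norm (ip x y * ip y x) = (norm (ip y x))\<^sup>2"
  by (metis cstar_identity ip_star)

text \<open>The estimates \<open>1 / D \<le> S \<le> K\<close> for the frame operator \<open>S\<close> hold in norm and, applied to all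
  multiples \<open>act a x\<close>, in the order of the algebra; so \<open>1 - S / K\<close> is a contraction.\<close>

lemma frame_operator_contraction:
  assumes gen: "\<And>x. \<exists>a. x = (\<Sum>i\<in>I. act (a i) (g i))" and fin: "finite I"
  obtains f q where "0 \<le> q" "q < 1"
    "\<And>x. nrm (x - (\<Sum>i\<in>I. act (ip x (f i)) (f i))) \<le> q * nrm x"
proof -
  obtain C where C: "C \<ge> 0" "\<And>x. nrm x \<le> C * (\<Sum>i\<in>I. norm (ip (g i) x))"
    by (rule generators_norm_bound[OF gen fin]) (rule that)
  define Q where "Q = (\<lambda>x y. \<Sum>i\<in>I. ip x (g i) * ip (g i) y)"
  have Q_pos: "cstar_pos (Q x x)" for x
    unfolding Q_def by (intro cstar_pos_sum cstar_pos_ip_mult_ip)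
  have Q_act: "Q (act a x) (act a x) = a * Q x x * star a" for a x
    by (simp add: Q_def ip_act_left form_act_right sum_distrib_left sum_distrib_right mult.assoc)
  \<comment> \<open>Each of the \<open>card I\<close> norms in the generator estimate is at most the
    root of \<open>norm (Q x x)\<close>. The summands 1 make \<open>D\<close> and \<open>K\<close>
    at least 1, so that \<open>q = 1 - 1 / (K * D)\<close> falls into \<open>[0, 1)\<close>.\<close>
  define D where "D = (C * card I)\<^sup>2 + 1"
  define K where "K = (\<Sum>i\<in>I. (nrm (g i))\<^sup>2) + 1"
  have D: "D \<ge> 1" by (simp add: D_def)
  have K: "K \<ge> 1" by (simp add: K_def sum_nonneg)
  have lower: "norm (ip x x) \<le> norm (D *\<^sub>R Q x x)" for x
  proof -
    have "norm (ip (g i) x) \<le> sqrt (norm (Q x x))" if i: "i \<in> I" for i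
    proof (rule real_le_rsqrt)
      have "Q x x - ip x (g i) * ip (g i) x = (\<Sum>i\<in>I - {i}. ip x (g i) * ip (g i) x)"
        unfolding Q_def using i fin by (simp add: sum.remove)
      moreover have "cstar_pos (\<Sum>i\<in>I - {i}. ip x (g i) * ip (g i) x)"
        by (intro cstar_pos_sum cstar_pos_ip_mult_ip)
      ultimately have "norm (ip x (g i) * ip (g i) x) \<le> norm (Q x x)"
        by (intro norm_mono_cstar_pos cstar_pos_ip_mult_ip) simp
      then show "(norm (ip (g i) x))\<^sup>2 \<le> norm (Q x x)" by (simp add: norm_ip_mult_ip)
    qed
    then have "(\<Sum>i\<in>I. norm (ip (g i) x)) \<le> card I * sqrt (norm (Q x x))"
      by (rule sum_bounded_above)
    then have "nrm x \<le> C * (card I * sqrt (norm (Q x x)))"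
      using C by (meson mult_left_mono order_trans)
    then have "(nrm x)\<^sup>2 \<le> (C * (card I * sqrt (norm (Q x x))))\<^sup>2" by (intro power_mono) auto
    also have "\<dots> = (C * card I)\<^sup>2 * norm (Q x x)" by (simp add: power_mult_distrib)
    also have "\<dots> \<le> D * norm (Q x x)" by (intro mult_right_mono) (simp_all add: D_def)
    finally show ?thesis using D by (simp add: nrm_square)
  qed
  have upper: "norm (Q x x) \<le> norm (K *\<^sub>R ip x x)" for x
  proof -
    have "norm (Q x x) \<le> (\<Sum>i\<in>I. norm (ip x (g i) * ip (g i) x))"
      unfolding Q_def by (rule norm_sum)
    also have "\<dots> \<le> (\<Sum>i\<in>I. (nrm (g i))\<^sup>2 * (nrm x)\<^sup>2)"
      by (intro sum_mono) (simp add: norm_ip_mult_ip norm_form_le power_mono flip: power_mult_distrib)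
    also have "\<dots> = (\<Sum>i\<in>I. (nrm (g i))\<^sup>2) * (nrm x)\<^sup>2" by (simp add: sum_distrib_right)
    also have "\<dots> \<le> K * (nrm x)\<^sup>2" by (intro mult_right_mono) (simp_all add: K_def)
    finally show ?thesis using K by (simp add: nrm_square)
  qed
  have ord_lower: "cstar_pos (D *\<^sub>R Q x x - ip x x)" for x
  proof (rule cstar_le_if_conjugate_norm_le)
    show "star (ip x x) = ip x x" by (metis ip_star)
    show "cstar_pos (D *\<^sub>R Q x x)" using Q_pos D by (intro cstar_pos_scaleR) auto
    show "norm (a * ip x x * star a) \<le> norm (a * (D *\<^sub>R Q x x) * star a)" for a
      using lower[of "act a x"] by (simp add: Q_act ip_act_left form_act_right mult.assoc)
  qed
  have ord_upper: "cstar_pos (K *\<^sub>R ip x x - Q x x)" for x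
  proof (rule cstar_le_if_conjugate_norm_le)
    show "star (Q x x) = Q x x" using Q_pos cstar_posD(1) by blast
    show "cstar_pos (K *\<^sub>R ip x x)" using ip_pos K by (intro cstar_pos_scaleR) auto
    show "norm (a * Q x x * star a) \<le> norm (a * (K *\<^sub>R ip x x) * star a)" for a
      using upper[of "act a x"] by (simp add: Q_act ip_act_left form_act_right mult.assoc)
  qed
  define f where "f = (\<lambda>i. complex_of_real (1 / sqrt K) *\<^sub>C g i)"
  define X where "X = (\<lambda>x. x - (\<Sum>i\<in>I. act (ip x (f i)) (f i)))"
  define q where "q = 1 - 1 / (K * D)"
  have KD: "K * D \<ge> 1" using K D mult_mono[of 1 K 1 D] by simp
  then have q: "0 \<le> q" "q < 1" by (auto simp: q_def)
  have ip_X: "ip (X x) y = ip x y - (1 / K) *\<^sub>R Q x y" for x y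
  proof -
    have "ip x (f i) * ip (f i) y = (1 / K) *\<^sub>R (ip x (g i) * ip (g i) y)" for i
      using K by (simp add: f_def ip_scaleC_left ip_scaleC_right
          scaleC_of_real[of "1 / sqrt K", simplified])
    then show ?thesis
      by (simp add: X_def form_diff_left ip_frame_operator Q_def scaleR_sum_right)
  qed
  \<comment> \<open>The order bounds only say \<open>0 \<le> X \<le> q\<close> as quadratic forms.
    Cauchy-Schwarz for this very form, applied to \<open>x\<close> and \<open>X x\<close>, turns the
    bound on \<open>ip (X x) x\<close> into one on \<open>nrm (X x)\<close>.\<close>
  interpret X: cstar_form act "\<lambda>x y. ip (X x) y"
  proof
    fix x y z a
    have "cstar_pos ((1 / K) *\<^sub>R (K *\<^sub>R ip x x - Q x x))"
      using K by (intro cstar_pos_scaleR ord_upper) auto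
    then show "cstar_pos (ip (X x) x)" using K by (simp add: ip_X scaleR_diff_right)
    have "star (Q y x) = Q x y" by (simp add: Q_def star_sum star_mult flip: ip_star)
    then show "ip (X x) y = star (ip (X y) x)"
      by (simp add: ip_X star_diff star_scaleR flip: ip_star)
    show "ip (X (act a x)) y = a * ip (X x) y"
      by (simp add: ip_X Q_def ip_act_left sum_distrib_left mult.assoc algebra_simps)
    show "ip (X (x + y)) z = ip (X x) z + ip (X y) z"
      by (simp add: ip_X Q_def ip_add_left sum.distrib algebra_simps)
  qed
  have XX: "norm (ip (X x) x) \<le> q * (nrm x)\<^sup>2" for x
  proof -
    have "cstar_pos ((1 / (K * D)) *\<^sub>R (D *\<^sub>R Q x x - ip x x))"
      using K D by (intro cstar_pos_scaleR ord_lower) auto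
    moreover have "(1 / (K * D)) *\<^sub>R (D *\<^sub>R Q x x - ip x x) = q *\<^sub>R ip x x - ip (X x) x"
      using K D by (simp add: ip_X q_def scaleR_diff_right scaleR_diff_left)
    ultimately have "norm (ip (X x) x) \<le> norm (q *\<^sub>R ip x x)"
      using norm_mono_cstar_pos X.form_pos by metis
    then show ?thesis using q by (simp add: nrm_square)
  qed
  have "nrm (X x) \<le> q * nrm x" for x
  proof (cases "nrm (X x) = 0")
    case False
    then have n: "nrm (X x) > 0" using nrm_nonneg[of "X x"] by linarith
    have "((nrm (X x))\<^sup>2)\<^sup>2 \<le> norm (ip (X x) x) * norm (ip (X (X x)) (X x))"
      using X.Cauchy_Schwarz[of x "X x"] by (simp add: nrm_square)
    also have "\<dots> \<le> (q * (nrm x)\<^sup>2) * (q * (nrm (X x))\<^sup>2)"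
      using XX q by (intro mult_mono) auto
    finally have "(nrm (X x))\<^sup>2 * (nrm (X x))\<^sup>2 \<le> (q * nrm x)\<^sup>2 * (nrm (X x))\<^sup>2"
      by (simp add: power2_eq_square mult.assoc mult.left_commute)
    then have "(nrm (X x))\<^sup>2 \<le> (q * nrm x)\<^sup>2"
      by (rule mult_right_le_imp_le) (use False in simp)
    then show ?thesis using q by (intro power2_le_imp_le[of "nrm (X x)"]) auto
  qed (use q in simp)
  then show ?thesis using q by (intro that[of q f]) (auto simp: X_def)
qed

end

subsection \<open>Normalized tight frames\<close>

lemma scaleC_sum: "c *\<^sub>C (\<Sum>i\<in>I. f i) = (\<Sum>i\<in>I. c *\<^sub>C (f i :: 'a::complex_vector))"
  by (induction I rule: infinite_finite_induct) (simp_all add: scaleC_add_right)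

section \<open>Newton iteration for the inverse square root of an operator\<close>

primrec newton_error :: "('m::complex_vector \<Rightarrow> 'm) \<Rightarrow> nat \<Rightarrow> 'm \<Rightarrow> 'm" where
  "newton_error X 0 = X"
| "newton_error X (Suc n) = (\<lambda>x. (3/4) *\<^sub>C newton_error X n (newton_error X n x)
     + (1/4) *\<^sub>C newton_error X n (newton_error X n (newton_error X n x)))"

text \<open>The iteration \<open>R \<mapsto> R (1 + E / 2)\<close>, where \<open>E = 1 - (1 - X) R\<^sup>2\<close>, converges to
  \<open>(1 - X) powr (- 1 / 2)\<close>; the error evolves by \<open>E \<mapsto> 3/4 E\<^sup>2 + 1/4 E\<^sup>3\<close>.\<close>

primrec newton_root :: "('m::complex_vector \<Rightarrow> 'm) \<Rightarrow> nat \<Rightarrow> 'm \<Rightarrow> 'm" where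
  "newton_root X 0 = (\<lambda>x. x)"
| "newton_root X (Suc n) = (\<lambda>x. newton_root X n x + (1/2) *\<^sub>C newton_root X n (newton_error X n x))"

definition complex_linear :: "('m::complex_vector \<Rightarrow> 'n::complex_vector) \<Rightarrow> bool" where
  "complex_linear f \<longleftrightarrow> (\<forall>x y. f (x + y) = f x + f y) \<and> (\<forall>c x. f (c *\<^sub>C x) = c *\<^sub>C f x)"

lemma complex_linear_add: "complex_linear f \<Longrightarrow> f (x + y) = f x + f y"
  and complex_linear_scaleC: "complex_linear f \<Longrightarrow> f (c *\<^sub>C x) = c *\<^sub>C f x"
  by (simp_all add: complex_linear_def)

lemma complex_linear_diff: "complex_linear f \<Longrightarrow> f (x - y) = f x - f y"
  using complex_linear_add[of f "x - y" y] by simp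

lemma complex_linear_newton:
  assumes "complex_linear X"
  shows "complex_linear (newton_error X n)" "complex_linear (newton_root X n)"
proof -
  show E: "complex_linear (newton_error X n)" for n
    by (induction n) (use assms in \<open>auto simp: complex_linear_def scaleC_add_right scaleC_scaleC
        mult.commute algebra_simps\<close>)
  show "complex_linear (newton_root X n)"
  proof (induction n)
    case (Suc n)
    then show ?case
      using E[of n] by (auto simp: complex_linear_def scaleC_add_right scaleC_scaleC mult.commute
        algebra_simps)
  qed (simp add: complex_linear_def)
qed

text \<open>The iterates are polynomials in \<open>X\<close>. With \<open>f = X\<close> and
  \<open>f = newton_error X n\<close> this makes roots, errors and \<open>X\<close> commute.\<close>

lemma newton_commute:
  assumes f: "complex_linear f" "\<And>x. f (X x) = X (f x)"
  shows "f (newton_error X n x) = newton_error X n (f x)"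
    "f (newton_root X n x) = newton_root X n (f x)"
proof -
  show E: "f (newton_error X n x) = newton_error X n (f x)" for n x
    by (induction n arbitrary: x)
      (simp_all add: f complex_linear_add[OF f(1)] complex_linear_scaleC[OF f(1)])
  show "f (newton_root X n x) = newton_root X n (f x)"
    by (induction n arbitrary: x)
      (simp_all add: E complex_linear_add[OF f(1)] complex_linear_scaleC[OF f(1)])
qed

lemma newton_root_square:
  assumes X: "complex_linear X"
  shows "newton_root X n (newton_root X n x) - X (newton_root X n (newton_root X n x))
    = x - newton_error X n x"
proof (induction n arbitrary: x)
  case (Suc n)
  define R where "R = newton_root X n"
  define E where "E = newton_error X n"
  have lin: "complex_linear R" "complex_linear E"
    using complex_linear_newton[OF X] by (simp_all add: R_def E_def)
  have XE: "E (X y) = X (E y)" for y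
    unfolding E_def by (rule newton_commute(1)[where f = X and X = X, OF X refl, symmetric])
  have ER: "E (R y) = R (E y)" for y
    unfolding R_def by (rule newton_commute(2)[where f = E and X = X, OF lin(2) XE])
  \<comment> \<open>\<open>u\<close> is \<open>(1 + E / 2)^2\<close> applied to \<open>x\<close>.
    The square of the new root at \<open>x\<close> is the square of the old one at \<open>u\<close>,
    so the induction hypothesis is used at \<open>u\<close>.\<close>
  define u where "u = x + E x + (1/4) *\<^sub>C E (E x)"
  have half: "(1/2) *\<^sub>C y + (1/2) *\<^sub>C y = y" for y :: 'a
    by (simp add: scaleC_one flip: scaleC_add_left)
  have quarter: "y - (1/4) *\<^sub>C y = (3/4) *\<^sub>C y" for y :: 'a
    using scaleC_diff_left[of 1 "1/4" y] by (simp add: scaleC_one)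
  have "newton_root X (Suc n) (newton_root X (Suc n) x)
      = R (R x) + ((1/2) *\<^sub>C R (R (E x)) + (1/2) *\<^sub>C R (R (E x))) + (1/4) *\<^sub>C R (R (E (E x)))"
    by (simp add: R_def[symmetric] E_def[symmetric] complex_linear_add[OF lin(1)]
        complex_linear_add[OF lin(2)] complex_linear_scaleC[OF lin(1)]
        complex_linear_scaleC[OF lin(2)] ER scaleC_add_right scaleC_scaleC add.assoc)
  also have "\<dots> = R (R u)"
    unfolding half by (simp add: u_def complex_linear_add[OF lin(1)] complex_linear_scaleC[OF lin(1)])
  finally have RR: "newton_root X (Suc n) (newton_root X (Suc n) x) = R (R u)" .
  have "R (R u) - X (R (R u)) = u - E u" unfolding R_def E_def by (rule Suc.IH)
  also have "\<dots> = x - (E (E x) - (1/4) *\<^sub>C E (E x)) - (1/4) *\<^sub>C E (E (E x))"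
    by (simp add: u_def complex_linear_add[OF lin(2)] complex_linear_scaleC[OF lin(2)] algebra_simps)
  also have "\<dots> = x - newton_error X (Suc n) x"
    unfolding quarter by (simp add: E_def[symmetric])
  finally show ?case unfolding RR .
qed simp

text \<open>The same recursion for the number \<open>q\<close> in place of \<open>X\<close>. Its
  coefficients are nonnegative, so it majorizes the norms of the operator iterates; likewise for
  \<open>newton_root_bound\<close>.\<close>

primrec newton_error_bound :: "real \<Rightarrow> nat \<Rightarrow> real" where
  "newton_error_bound q 0 = q"
| "newton_error_bound q (Suc n) = 3/4 * (newton_error_bound q n)\<^sup>2 + 1/4 * (newton_error_bound q n) ^ 3"

primrec newton_root_bound :: "real \<Rightarrow> nat \<Rightarrow> real" where
  "newton_root_bound q 0 = 1"
| "newton_root_bound q (Suc n) =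
     newton_root_bound q n + 1/2 * (newton_root_bound q n * newton_error_bound q n)"

lemma newton_error_bound_le:
  assumes "0 \<le> q" "q < 1"
  shows "0 \<le> newton_error_bound q n \<and> newton_error_bound q n \<le> q ^ Suc n"
proof (induction n)
  case (Suc n)
  define e where "e = newton_error_bound q n"
  have "q ^ Suc n \<le> q" using assms mult_left_le[of "q ^ n" q] by (simp add: power_le_one)
  then have e: "0 \<le> e" "e \<le> q ^ Suc n" "e \<le> q" "e \<le> 1" using Suc assms by (auto simp: e_def)
  have "e ^ 3 \<le> e\<^sup>2" using e power_decreasing[of 2 3 e] by simp
  then have "3/4 * e\<^sup>2 + 1/4 * e ^ 3 \<le> e * e" by (simp add: power2_eq_square)
  also have "\<dots> \<le> q * q ^ Suc n" using e by (intro mult_mono) auto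
  finally show ?case using e by (simp add: e_def[symmetric])
qed (use assms in simp)

lemma newton_error_bound_tendsto:
  assumes "0 \<le> q" "q < 1" shows "newton_error_bound q \<longlonglongrightarrow> 0"
proof (rule tendsto_sandwich[OF _ _ tendsto_const])
  show "(\<lambda>n. q ^ Suc n) \<longlonglongrightarrow> 0" using assms by (intro LIMSEQ_Suc LIMSEQ_realpow_zero)
  show "\<forall>\<^sub>F n in sequentially. newton_error_bound q n \<le> q ^ Suc n"
    "\<forall>\<^sub>F n in sequentially. 0 \<le> newton_error_bound q n"
    using newton_error_bound_le[OF assms] by (auto intro: always_eventually)
qed

lemma newton_root_bound_nonneg:
  assumes "0 \<le> q" "q < 1" shows "0 \<le> newton_root_bound q n"
  by (induction n) (simp_all add: newton_error_bound_le[OF assms])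

text \<open>The scalar form of \<open>newton_root_square\<close>; it bounds the increasing root
  iterates by \<open>(1 - q)\<close> to the power \<open>-1/2\<close>.\<close>

lemma newton_root_bound_square:
  "(1 - q) * (newton_root_bound q n)\<^sup>2 = 1 - newton_error_bound q n"
proof (induction n)
  case (Suc n)
  define r where "r = newton_root_bound q n"
  define e where "e = newton_error_bound q n"
  have "(1 - q) * (r + 1/2 * (r * e))\<^sup>2 = ((1 - q) * r\<^sup>2) * (1 + e / 2)\<^sup>2"
  proof -
    have "r + 1/2 * (r * e) = r * (1 + e / 2)" by (simp add: algebra_simps)
    then show ?thesis by (simp only: power_mult_distrib mult.assoc)
  qed
  also have "\<dots> = (1 - e) * (1 + e / 2)\<^sup>2" using Suc by (simp add: r_def e_def)
  also have "\<dots> = 1 - (3/4 * e\<^sup>2 + 1/4 * e ^ 3)"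
    by (simp add: power2_eq_square power3_eq_cube field_simps)
  finally show ?case by (simp add: r_def[symmetric] e_def[symmetric])
qed simp

lemma newton_root_bound_incseq:
  assumes "0 \<le> q" "q < 1" shows "incseq (newton_root_bound q)"
  using newton_root_bound_nonneg[OF assms] newton_error_bound_le[OF assms]
  by (intro incseq_SucI) simp

lemma newton_root_bound_Cauchy:
  assumes "0 \<le> q" "q < 1" shows "Cauchy (newton_root_bound q)"
proof -
  have "newton_root_bound q n \<le> sqrt (1 / (1 - q))" for n
  proof (rule real_le_rsqrt)
    have "(1 - q) * (newton_root_bound q n)\<^sup>2 \<le> 1"
      using newton_root_bound_square[of q n] newton_error_bound_le[OF assms, of n] by simp
    then show "(newton_root_bound q n)\<^sup>2 \<le> 1 / (1 - q)" using assms by (simp add: field_simps)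
  qed
  then have "convergent (newton_root_bound q)"
    using incseq_convergent[OF newton_root_bound_incseq[OF assms]] convergentI by metis
  then show ?thesis by (rule convergent_Cauchy)
qed

text \<open>Polarization: the diagonal at \<open>x + y\<close> gives the symmetric part, and
  replacing \<open>x\<close> by \<open>\<i> *\<^sub>C x\<close> gives the antisymmetric one.\<close>

lemma sesquilinear_eq_if_diagonal_eq:
  fixes P Q :: "'m::complex_vector \<Rightarrow> 'm \<Rightarrow> 'a::unital_cstar_algebra"
  assumes P: "\<And>x y z. P (x + y) z = P x z + P y z" "\<And>x y z. P x (y + z) = P x y + P x z"
      "\<And>c x y. P (c *\<^sub>C x) y = c *\<^sub>C P x y" "\<And>c x y. P x (c *\<^sub>C y) = cnj c *\<^sub>C P x y"
    and Q: "\<And>x y z. Q (x + y) z = Q x z + Q y z" "\<And>x y z. Q x (y + z) = Q x y + Q x z"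
      "\<And>c x y. Q (c *\<^sub>C x) y = c *\<^sub>C Q x y" "\<And>c x y. Q x (c *\<^sub>C y) = cnj c *\<^sub>C Q x y"
    and diag: "\<And>x. P x x = Q x x"
  shows "P x y = Q x y"
proof -
  have re: "P x y + P y x = Q x y + Q y x" for x y
    using diag[of "x + y"] diag[of x] diag[of y] by (simp add: P Q algebra_simps)
  have "\<i> *\<^sub>C (P x y - P y x) = \<i> *\<^sub>C (Q x y - Q y x)"
    using re[of "\<i> *\<^sub>C x" y] by (simp add: P Q scaleC_minus_left scaleC_diff_right)
  then have "(- \<i>) *\<^sub>C \<i> *\<^sub>C (P x y - P y x) = (- \<i>) *\<^sub>C \<i> *\<^sub>C (Q x y - Q y x)"
    by simp
  then have "P x y - P y x = Q x y - Q y x"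
    by (simp only: scaleC_scaleC) (simp add: scaleC_one)
  from arg_cong2[OF re[of x y] this, of "(+)"]
  have "(2::real) *\<^sub>R P x y = 2 *\<^sub>R Q x y" by (simp add: scaleR_2)
  then show ?thesis by simp
qed

context hilbert_module
begin

lemma nrm_newton_error_le:
  assumes q: "0 \<le> q" "q < 1" and X: "\<And>x. nrm (X x) \<le> q * nrm x"
  shows "nrm (newton_error X n x) \<le> newton_error_bound q n * nrm x"
proof (induction n arbitrary: x)
  case (Suc n)
  define E where "E = newton_error X n"
  define e where "e = newton_error_bound q n"
  have e: "0 \<le> e" using newton_error_bound_le[OF q] by (simp add: e_def)
  have IH: "nrm (E y) \<le> e * nrm y" for y unfolding E_def e_def by (rule Suc.IH)
  have 2: "nrm (E (E x)) \<le> e\<^sup>2 * nrm x"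
    using order_trans[OF IH mult_left_mono[OF IH e]] by (simp add: power2_eq_square mult.assoc)
  have 3: "nrm (E (E (E x))) \<le> e ^ 3 * nrm x"
    using order_trans[OF IH mult_left_mono[OF 2 e]]
    by (simp add: power2_eq_square power3_eq_cube mult.assoc)
  have "nrm (newton_error X (Suc n) x) \<le> 3/4 * nrm (E (E x)) + 1/4 * nrm (E (E (E x)))"
    using nrm_triangle[of "(3/4) *\<^sub>C E (E x)" "(1/4) *\<^sub>C E (E (E x))"]
    by (simp add: nrm_scaleC E_def[symmetric])
  also have "\<dots> \<le> 3/4 * (e\<^sup>2 * nrm x) + 1/4 * (e ^ 3 * nrm x)" using 2 3 by simp
  also have "\<dots> = newton_error_bound q (Suc n) * nrm x" by (simp add: e_def[symmetric] distrib_right)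
  finally show ?case .
qed (simp add: X)

lemma nrm_newton_root_step_le:
  assumes q: "0 \<le> q" "q < 1" and X: "\<And>x. nrm (X x) \<le> q * nrm x"
  shows "nrm (newton_root X n x) \<le> newton_root_bound q n * nrm x"
    "nrm (newton_root X (Suc n) x - newton_root X n x)
       \<le> (newton_root_bound q (Suc n) - newton_root_bound q n) * nrm x"
proof -
  have step: "nrm (newton_root X (Suc n) x - newton_root X n x)
       \<le> (newton_root_bound q (Suc n) - newton_root_bound q n) * nrm x"
    if "\<And>x. nrm (newton_root X n x) \<le> newton_root_bound q n * nrm x" for n x
  proof -
    have "nrm (newton_root X n (newton_error X n x)) \<le> newton_root_bound q n * nrm (newton_error X n x)"
      by (rule that)
    also have "\<dots> \<le> newton_root_bound q n * (newton_error_bound q n * nrm x)"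
      by (intro mult_left_mono nrm_newton_error_le q X newton_root_bound_nonneg)
    finally show ?thesis by (simp add: nrm_scaleC)
  qed
  show bound: "nrm (newton_root X n x) \<le> newton_root_bound q n * nrm x" for n x
  proof (induction n arbitrary: x)
    case (Suc n)
    show ?case
      using nrm_triangle[of "newton_root X n x" "newton_root X (Suc n) x - newton_root X n x"]
        Suc[of x] step[of n x, OF Suc] by (simp add: distrib_right left_diff_distrib)
  qed simp
  show "nrm (newton_root X (Suc n) x - newton_root X n x)
       \<le> (newton_root_bound q (Suc n) - newton_root_bound q n) * nrm x"
    by (rule step[OF bound])
qed

text \<open>Increments of the operator roots are dominated by those of the scalar roots, which form
  a Cauchy sequence. Convergence at single vectors is what the frame needs.\<close>

lemma newton_root_convergent:
  assumes q: "0 \<le> q" "q < 1" and X: "\<And>x. nrm (X x) \<le> q * nrm x"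
  shows "\<exists>y. (\<lambda>n. nrm (newton_root X n x - y)) \<longlonglongrightarrow> 0"
proof (rule complete, intro allI impI)
  define b where "b = newton_root_bound q"
  have tele: "nrm (newton_root X n x - newton_root X m x) \<le> (b n - b m) * nrm x" if "m \<le> n" for m n
    using that
  proof (induction n rule: dec_induct)
    case (step n)
    then show ?case
      using nrm_triangle_diff[of "newton_root X (Suc n) x" "newton_root X m x" "newton_root X n x"]
        nrm_newton_root_step_le(2)[OF q X, where n = n and x = x]
      by (simp add: b_def left_diff_distrib del: newton_root.simps newton_root_bound.simps)
  qed simp
  have dist_le: "nrm (newton_root X m x - newton_root X n x) \<le> \<bar>b m - b n\<bar> * nrm x" for m n
  proof (cases "m \<le> n")
    case True
    have "(b n - b m) * nrm x \<le> \<bar>b m - b n\<bar> * nrm x" by (intro mult_right_mono) auto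
    then show ?thesis using tele[OF True] by (simp add: nrm_minus_commute)
  next
    case False
    have "(b m - b n) * nrm x \<le> \<bar>b m - b n\<bar> * nrm x" by (intro mult_right_mono) auto
    then show ?thesis using tele[of n m] False by simp
  qed
  fix e :: real assume e: "e > 0"
  have pos: "nrm x + 1 > 0" using nrm_nonneg[of x] by linarith
  obtain n0 where n0: "\<And>m n. m \<ge> n0 \<Longrightarrow> n \<ge> n0 \<Longrightarrow> \<bar>b m - b n\<bar> < e / (nrm x + 1)"
    using newton_root_bound_Cauchy[OF q] e pos unfolding Cauchy_def b_def dist_real_def
    by (metis divide_pos_pos)
  show "\<exists>n0. \<forall>m\<ge>n0. \<forall>n\<ge>n0. nrm (newton_root X m x - newton_root X n x) < e"
  proof (intro exI[of _ n0] allI impI)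
    fix m n assume "n0 \<le> m" "n0 \<le> n"
    then have "\<bar>b m - b n\<bar> * (nrm x + 1) < e"
      using n0[of m n] pos by (simp add: pos_less_divide_eq)
    moreover have "\<bar>b m - b n\<bar> * nrm x \<le> \<bar>b m - b n\<bar> * (nrm x + 1)" by (intro mult_left_mono) auto
    ultimately show "nrm (newton_root X m x - newton_root X n x) < e" using dist_le[of m n] by linarith
  qed
qed

text \<open>Taking adjoints reverses the product of root and error in the recursion; commutation
  restores the order.\<close>

lemma newton_adjoint:
  assumes X: "\<And>x y. ip (X x) y = ip x (X y)" "complex_linear X"
  shows "ip (newton_root X n x) y = ip x (newton_root X n y)"
proof -
  have E: "ip (newton_error X n x) y = ip x (newton_error X n y)" for n x y
    by (induction n arbitrary: x y)
      (simp_all add: X ip_scaleC_left ip_scaleC_right form_add_left form_add_right)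
  have comm: "newton_root X n (newton_error X n y) = newton_error X n (newton_root X n y)" for n y
    using newton_commute(2)[of "newton_error X n" X n y] complex_linear_newton(1)[OF X(2)]
      newton_commute(1)[where f = X and X = X, OF X(2) refl, symmetric] by metis
  show ?thesis
    by (induction n arbitrary: x y)
      (simp_all add: E comm ip_scaleC_left ip_scaleC_right form_add_left form_add_right)
qed

text \<open>No limit operator is formed: only the vectors \<open>R n (g i)\<close> converge. At
  finite \<open>n\<close> the frame sum equals \<open>ip x x - ip (newton_error X n x) x\<close>,
  and the limit is taken in this identity.\<close>

lemma normalized_tight_frame_exists_of_contraction:
  assumes q: "0 \<le> q" "q < 1"
    and contr: "\<And>x. nrm (x - (\<Sum>i\<in>I. act (ip x (g i)) (g i))) \<le> q * nrm x"
  obtains f where "\<And>x. ip x x = (\<Sum>i\<in>I. ip x (f i) * ip (f i) x)"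
proof -
  define X where "X = (\<lambda>x. x - (\<Sum>i\<in>I. act (ip x (g i)) (g i)))"
  have X: "\<And>x. nrm (X x) \<le> q * nrm x" using contr by (simp add: X_def)
  have lin: "complex_linear X"
    by (simp add: complex_linear_def X_def ip_add_left act_add_left act_add_right sum.distrib
        scaleC_diff_right ip_scaleC_left act_scaleC_left scaleC_sum)
  have adj: "ip (X x) y = ip x (X y)" for x y
  proof -
    have "ip x (X y) = star (ip (X y) x)" by (rule ip_star)
    also have "\<dots> = ip x y - (\<Sum>i\<in>I. ip x (g i) * ip (g i) y)"
      by (simp add: X_def form_diff_left ip_frame_operator star_diff star_sum star_mult flip: ip_star)
    also have "\<dots> = ip (X x) y" by (simp add: X_def form_diff_left ip_frame_operator)
    finally show ?thesis by simp
  qed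
  define R where "R = newton_root X"
  have "\<exists>f. \<forall>i. (\<lambda>n. nrm (R n (g i) - f i)) \<longlonglongrightarrow> 0"
    unfolding R_def by (intro choice allI newton_root_convergent[OF q X])
  then obtain f where f: "\<And>i. (\<lambda>n. nrm (R n (g i) - f i)) \<longlonglongrightarrow> 0" by blast
  have "ip x x = (\<Sum>i\<in>I. ip x (f i) * ip (f i) x)" for x
  proof (rule LIMSEQ_unique)
    have right: "(\<lambda>n. ip x (R n (g i))) \<longlonglongrightarrow> ip x (f i)" for i
    proof (rule LIM_zero_cancel, rule Lim_null_comparison)
      show "\<forall>\<^sub>F n in sequentially. norm (ip x (R n (g i)) - ip x (f i))
          \<le> nrm x * nrm (R n (g i) - f i)"
        by (intro always_eventually allI) (simp add: norm_form_le flip: form_diff_right)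
      show "(\<lambda>n. nrm x * nrm (R n (g i) - f i)) \<longlonglongrightarrow> 0"
        using tendsto_mult_right_zero[OF f] .
    qed
    have left: "(\<lambda>n. ip (R n (g i)) x) \<longlonglongrightarrow> ip (f i) x" for i
      using bounded_linear.tendsto[OF bounded_linear_star right] by (simp flip: ip_star)
    have "ip x x - ip (newton_error X n x) x = (\<Sum>i\<in>I. ip x (R n (g i)) * ip (R n (g i)) x)" for n
    proof -
      have adjR: "ip (R n y) z = ip y (R n z)" for y z
        unfolding R_def by (rule newton_adjoint[OF adj lin])
      have "(\<Sum>i\<in>I. ip x (R n (g i)) * ip (R n (g i)) x)
          = (\<Sum>i\<in>I. ip (R n x) (g i) * ip (g i) (R n x))" by (simp add: adjR)
      also have "\<dots> = ip (R n x - X (R n x)) (R n x)" by (simp add: X_def ip_frame_operator)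
      also have "\<dots> = ip (R n (R n x) - X (R n (R n x))) x"
        using complex_linear_newton(2)[OF lin, of n]
          newton_commute(2)[where f = X and X = X, OF lin refl, of n "R n x"]
        by (simp add: R_def complex_linear_diff flip: newton_adjoint[OF adj lin])
      also have "\<dots> = ip (x - newton_error X n x) x"
        unfolding R_def newton_root_square[OF lin] ..
      finally show ?thesis by (simp add: form_diff_left)
    qed
    then show "(\<lambda>n. ip x x - ip (newton_error X n x) x) \<longlonglongrightarrow> (\<Sum>i\<in>I. ip x (f i) * ip (f i) x)"
      by (simp add: tendsto_sum tendsto_mult left right)
    have "(\<lambda>n. ip (newton_error X n x) x) \<longlonglongrightarrow> 0"
    proof (rule Lim_null_comparison)
      show "\<forall>\<^sub>F n in sequentially. norm (ip (newton_error X n x) x)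
          \<le> newton_error_bound q n * nrm x * nrm x"
      proof (intro always_eventually allI)
        fix n
        have "nrm (newton_error X n x) * nrm x \<le> newton_error_bound q n * nrm x * nrm x"
          by (intro mult_right_mono nrm_newton_error_le q X) simp
        then show "norm (ip (newton_error X n x) x) \<le> newton_error_bound q n * nrm x * nrm x"
          using norm_form_le order_trans by blast
      qed
      show "(\<lambda>n. newton_error_bound q n * nrm x * nrm x) \<longlonglongrightarrow> 0"
        by (intro tendsto_mult_left_zero newton_error_bound_tendsto q)
    qed
    from tendsto_diff[OF tendsto_const this]
    show "(\<lambda>n. ip x x - ip (newton_error X n x) x) \<longlonglongrightarrow> ip x x" by simp
  qed
  then show ?thesis by (rule that)
qed

lemma normalized_tight_frame_exists:
  assumes "finitely_generated act"
  obtains k f where "normalized_tight_frame ip k f" "\<And>i. i \<in> {1..k} \<Longrightarrow> f i \<noteq> 0"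
proof -
  obtain n and g :: "nat \<Rightarrow> 'm" where gen: "\<And>x. \<exists>a. x = (\<Sum>i = 1..n. act (a i) (g i))"
    using assms unfolding finitely_generated_def by blast
  obtain g' q where q: "0 \<le> q" "q < 1"
    "\<And>x. nrm (x - (\<Sum>i = 1..n. act (ip x (g' i)) (g' i))) \<le> q * nrm x"
    by (rule frame_operator_contraction[OF gen finite_atLeastAtMost]) (rule that)
  obtain f where f: "\<And>x. ip x x = (\<Sum>i = 1..n. ip x (f i) * ip (f i) x)"
    by (rule normalized_tight_frame_exists_of_contraction[OF q]) (rule that)
  \<comment> \<open>Vanishing members add nothing to the frame sum. If all of them vanish, the frame
    has length 0.\<close>
  define J where "J = {i \<in> {1..n}. f i \<noteq> 0}"
  obtain h where h: "bij_betw h {1..card J} J"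
    using ex_bij_betw_nat_finite_1[of J] by (auto simp: J_def)
  show thesis
  proof (rule that[of "card J" "f \<circ> h"])
    show "normalized_tight_frame ip (card J) (f \<circ> h)"
      unfolding normalized_tight_frame_def
    proof
      fix x
      have "ip x x = (\<Sum>i\<in>J. ip x (f i) * ip (f i) x)"
        unfolding f[of x] J_def by (rule sum.mono_neutral_right) auto
      also have "\<dots> = (\<Sum>j = 1..card J. ip x (f (h j)) * ip (f (h j)) x)"
        by (rule sum.reindex_bij_betw[OF h, symmetric])
      finally show "ip x x = (\<Sum>j = 1..card J. ip x ((f \<circ> h) j) * ip ((f \<circ> h) j) x)" by simp
    qed
    show "(f \<circ> h) i \<noteq> 0" if "i \<in> {1..card J}" for i
      using bij_betwE[OF h] that by (auto simp: J_def)
  qed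
qed

text \<open>The defining identity is diagonal; polarization extends it to pairs.\<close>

lemma frame_ip_expansion:
  assumes "normalized_tight_frame ip k f"
  shows "(\<Sum>j = 1..k. ip x (f j) * ip (f j) y) = ip x y"
proof (rule sesquilinear_eq_if_diagonal_eq[where Q = ip])
  fix x y z c
  show "(\<Sum>j = 1..k. ip (c *\<^sub>C x) (f j) * ip (f j) y) = c *\<^sub>C (\<Sum>j = 1..k. ip x (f j) * ip (f j) y)"
    "(\<Sum>j = 1..k. ip x (f j) * ip (f j) (c *\<^sub>C y)) = cnj c *\<^sub>C (\<Sum>j = 1..k. ip x (f j) * ip (f j) y)"
    by (simp_all add: ip_scaleC_left ip_scaleC_right scaleC_mult_left scaleC_mult_right scaleC_sum)
  show "(\<Sum>j = 1..k. ip x (f j) * ip (f j) x) = ip x x"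
    using assms by (simp add: normalized_tight_frame_def)
qed (simp_all add: form_add_left form_add_right ip_scaleC_left ip_scaleC_right sum.distrib
    distrib_left distrib_right)

lemma frame_expansion:
  assumes "normalized_tight_frame ip k f"
  shows "(\<Sum>j = 1..k. act (ip x (f j)) (f j)) = x"
  by (rule eq_if_ip_eq) (simp only: ip_frame_operator frame_ip_expansion[OF assms])

section \<open>Isometries, unitaries and Gram matrices\<close>

lemma module_linear_isometry_preserves_ip:
  assumes N: "hilbert_module actN ipN" and lin: "module_linear act actN T"
    and iso: "\<And>x. hm_norm ipN (T x) = nrm x"
  shows "ipN (T x) (T y) = ip x y"
proof -
  interpret N: hilbert_module actN ipN by fact
  have T: "T (x + y) = T x + T y" "T (act a x) = actN a (T x)" for a x y
    using lin by (auto simp: module_linear_def)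
  have TC: "T (c *\<^sub>C x) = c *\<^sub>C T x" for c x
    by (metis T(2) act_scaleC_one N.act_scaleC_one)
  have diag: "ipN (T x) (T x) = ip x x" for x
  proof -
    have norms: "norm (a * ipN (T x) (T x) * star a) = norm (a * ip x x * star a)" for a
    proof -
      have "(hm_norm ipN (T (act a x)))\<^sup>2 = (nrm (act a x))\<^sup>2" by (simp add: iso)
      then show ?thesis
        by (simp add: T N.nrm_square nrm_square ip_act_left form_act_right N.ip_act_left
            N.form_act_right mult.assoc)
    qed
    have sa: "star (ip x x) = ip x x" "star (ipN (T x) (T x)) = ipN (T x) (T x)"
      using ip_pos N.ip_pos cstar_posD(1) by blast+
    have "cstar_pos (ip x x - ipN (T x) (T x))" "cstar_pos (ipN (T x) (T x) - ip x x)"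
      by (intro cstar_le_if_conjugate_norm_le sa ip_pos N.ip_pos, simp add: norms)+
    then have "ip x x - ipN (T x) (T x) = 0" by (intro cstar_pos_antisym) simp_all
    then show ?thesis by simp
  qed
  show ?thesis
    by (rule sesquilinear_eq_if_diagonal_eq[where P = "\<lambda>x y. ipN (T x) (T y)"])
      (simp_all add: T TC diag ip_scaleC_left ip_scaleC_right N.ip_scaleC_left N.ip_scaleC_right
        form_add_left form_add_right N.form_add_left N.form_add_right)
qed

lemma isometrically_isomorphic_iff_unitarily_isomorphic:
  assumes N: "hilbert_module actN ipN"
  shows "isometrically_isomorphic act ip actN ipN \<longleftrightarrow> unitarily_isomorphic act ip actN ipN"
proof
  assume "isometrically_isomorphic act ip actN ipN"
  then obtain T where T: "module_linear act actN T" "bij T" "\<And>x. hm_norm ipN (T x) = nrm x"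
    by (auto simp: isometrically_isomorphic_def)
  then have "\<forall>x. hm_norm ipN (T x) \<le> 1 * nrm x" by simp
  with T module_linear_isometry_preserves_ip[OF N T(1,3)]
  show "unitarily_isomorphic act ip actN ipN" unfolding unitarily_isomorphic_def by blast
next
  assume "unitarily_isomorphic act ip actN ipN"
  then show "isometrically_isomorphic act ip actN ipN"
    unfolding unitarily_isomorphic_def isometrically_isomorphic_def hm_norm_def by metis
qed

lemma unitarily_isomorphic_if_frames:
  assumes N: "hilbert_module actN ipN"
    and x: "normalized_tight_frame ip k x" and y: "normalized_tight_frame ipN k y"
    and gram: "\<And>i j. i \<in> {1..k} \<Longrightarrow> j \<in> {1..k} \<Longrightarrow> ip (x i) (x j) = ipN (y i) (y j)"
  shows "unitarily_isomorphic act ip actN ipN"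
proof -
  interpret N: hilbert_module actN ipN by fact
  \<comment> \<open>Because \<open>T\<close> is given by inner products and not by prescribing
    images of the \<open>x i\<close>, relations among the \<open>x i\<close> raise no question of
    well-definedness.\<close>
  define T where "T = (\<lambda>z. \<Sum>i = 1..k. actN (ip z (x i)) (y i))"
  have T: "module_linear act actN T"
    by (simp add: module_linear_def T_def ip_add_left N.act_add_left sum.distrib ip_act_left
        N.act_act N.act_sum_right)
  have T_frame: "ipN (T z) (y j) = ip z (x j)" if "j \<in> {1..k}" for z j
  proof -
    have "ipN (T z) (y j) = (\<Sum>i = 1..k. ip z (x i) * ip (x i) (x j))"
      unfolding T_def N.form_sum_left N.ip_act_left by (intro sum.cong refl) (simp only: gram[OF _ that])
    then show ?thesis by (simp add: frame_ip_expansion[OF x] del: One_nat_def)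
  qed
  have ipT: "ipN (T z) (T w) = ip z w" for z w
  proof -
    have "ipN (T z) (T w) = (\<Sum>j = 1..k. ipN (T z) (y j) * ipN (y j) (T w))"
      by (simp add: N.frame_ip_expansion[OF y] del: One_nat_def)
    also have "\<dots> = (\<Sum>j = 1..k. ip z (x j) * ip (x j) w)"
    proof (intro sum.cong refl arg_cong2[where f = "(*)"] T_frame)
      fix j assume "j \<in> {1..k}"
      then have "star (ipN (T w) (y j)) = star (ip w (x j))" by (simp add: T_frame)
      then show "ipN (y j) (T w) = ip (x j) w" by (simp flip: ip_star N.ip_star)
    qed
    finally show ?thesis by (simp add: frame_ip_expansion[OF x] del: One_nat_def)
  qed
  have "inj T"
  proof (rule injI)
    fix z w assume "T z = T w"
    then have "ip z v = ip w v" for v by (metis ipT)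
    then show "z = w" by (rule eq_if_ip_eq)
  qed
  moreover have "v \<in> range T" for v
  proof -
    \<comment> \<open>The same formula with the two frames exchanged. Its frame coefficients are
      those of \<open>v\<close>, so \<open>T z\<close> is the frame expansion of
      \<open>v\<close>.\<close>
    define z where "z = (\<Sum>j = 1..k. act (ipN v (y j)) (x j))"
    have "ip z (x i) = ipN v (y i)" if "i \<in> {1..k}" for i
    proof -
      have "ip z (x i) = (\<Sum>j = 1..k. ipN v (y j) * ipN (y j) (y i))"
        unfolding z_def form_sum_left ip_act_left by (intro sum.cong refl) (simp only: gram[OF _ that])
      then show ?thesis by (simp add: N.frame_ip_expansion[OF y] del: One_nat_def)
    qed
    then have "T z = (\<Sum>i = 1..k. actN (ipN v (y i)) (y i))" unfolding T_def by simp
    then show ?thesis using N.frame_expansion[OF y] by (metis rangeI)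
  qed
  ultimately have "bij T" by (auto simp: bij_def)
  moreover have "\<forall>z. hm_norm ipN (T z) \<le> 1 * nrm z" by (simp add: hm_norm_def ipT)
  ultimately show ?thesis unfolding unitarily_isomorphic_def using T ipT by blast
qed

lemma frames_if_unitarily_isomorphic:
  assumes N: "hilbert_module actN ipN" and fg: "finitely_generated act"
    and iso: "unitarily_isomorphic act ip actN ipN"
  obtains k x y where "normalized_tight_frame ip k x" "normalized_tight_frame ipN k y"
    "\<And>i. i \<in> {1..k} \<Longrightarrow> x i \<noteq> 0 \<and> y i \<noteq> 0" "\<And>i j. ip (x i) (x j) = ipN (y i) (y j)"
proof -
  interpret N: hilbert_module actN ipN by fact
  obtain T where T: "bij T" "\<And>x y. ipN (T x) (T y) = ip x y"
    using iso by (auto simp: unitarily_isomorphic_def)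
  obtain k f where f: "normalized_tight_frame ip k f" "\<And>i. i \<in> {1..k} \<Longrightarrow> f i \<noteq> 0"
    by (rule normalized_tight_frame_exists[OF fg]) (rule that)
  have "normalized_tight_frame ipN k (\<lambda>i. T (f i))"
    unfolding normalized_tight_frame_def
  proof
    fix z
    obtain w where "z = T w" using T(1) by (metis bij_pointE)
    then show "ipN z z = (\<Sum>j = 1..k. ipN z (T (f j)) * ipN (T (f j)) z)"
      using f(1) by (simp add: T(2) normalized_tight_frame_def)
  qed
  moreover have "T (f i) \<noteq> 0" if "i \<in> {1..k}" for i
    using f(2)[OF that] T(2)[of "f i" "f i"] by (metis ip_eq_zero_iff N.ip_eq_zero_iff)
  ultimately show ?thesis using f T(2) by (intro that[of k f "\<lambda>i. T (f i)"]) auto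
qed

end

theorem theorem3p1:
  fixes actM :: "'a::unital_cstar_algebra \<Rightarrow> 'm::complex_vector \<Rightarrow> 'm"
    and ipM :: "'m \<Rightarrow> 'm \<Rightarrow> 'a"
    and actN :: "'a \<Rightarrow> 'n::complex_vector \<Rightarrow> 'n"
    and ipN :: "'n \<Rightarrow> 'n \<Rightarrow> 'a"
  assumes "hilbert_module actM ipM" and "finitely_generated actM"
    and "hilbert_module actN ipN" and "finitely_generated actN"
  shows "(isometrically_isomorphic actM ipM actN ipN \<longleftrightarrow>
            unitarily_isomorphic actM ipM actN ipN) \<and>
         (unitarily_isomorphic actM ipM actN ipN \<longleftrightarrow>
            (\<exists>k l x y. normalized_tight_frame ipM k x \<and> normalized_tight_frame ipN l y \<and>
               k = l \<and> (\<forall>i\<in>{1..k}. x i \<noteq> 0 \<and> y i \<noteq> 0) \<and>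
               (\<forall>i j. 1 \<le> i \<and> i \<le> j \<and> j \<le> k \<longrightarrow> ipM (x i) (x j) = ipN (y i) (y j))))"
    (is "(?iso \<longleftrightarrow> ?uni) \<and> (_ \<longleftrightarrow> ?frames)")
proof -
  interpret M: hilbert_module actM ipM by fact
  interpret N: hilbert_module actN ipN by fact
  have "?iso \<longleftrightarrow> ?uni"
    using assms(3) by (rule M.isometrically_isomorphic_iff_unitarily_isomorphic)
  moreover have ?frames if uni: ?uni
  proof -
    obtain k x y where "normalized_tight_frame ipM k x" "normalized_tight_frame ipN k y"
      "\<And>i. i \<in> {1..k} \<Longrightarrow> x i \<noteq> 0 \<and> y i \<noteq> 0" "\<And>i j. ipM (x i) (x j) = ipN (y i) (y j)"
      by (rule M.frames_if_unitarily_isomorphic[OF assms(3,2) uni]) (rule that)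
    then show ?thesis by (intro exI[of _ k] exI[of _ x] exI[of _ y]) simp
  qed
  moreover have ?uni if frames: ?frames
  proof -
    obtain k x y where f: "normalized_tight_frame ipM k x" "normalized_tight_frame ipN k y"
      and gram: "\<And>i j. 1 \<le> i \<Longrightarrow> i \<le> j \<Longrightarrow> j \<le> k \<Longrightarrow> ipM (x i) (x j) = ipN (y i) (y j)"
      using frames by blast
    have "ipM (x i) (x j) = ipN (y i) (y j)" if ij: "i \<in> {1..k}" "j \<in> {1..k}" for i j
    proof (cases "i \<le> j")
      case False
      then have "star (ipM (x j) (x i)) = star (ipN (y j) (y i))" using gram[of j i] ij by simp
      then show ?thesis by (simp flip: M.ip_star N.ip_star)
    qed (use gram ij in simp)
    then show ?thesis by (rule M.unitarily_isomorphic_if_frames[OF assms(3) f])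
  qed
  ultimately show ?thesis by blast
qed

end
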